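(* Let $\alpha\in(0,1)$ and let $f:\mathbb{D}\to\mathbb{C}$ be a strongly spirallike function of order $\alpha$. Then $f$ extends to a $\sin(\pi\alpha/2)$-quasiconformal automorphism of $\mathbb{C}$; that is, there is a $\sin(\pi\alpha/2)$-quasiconformal homeomorphism $F:\mathbb{C}\to\mathbb{C}$ with $F(z)=f(z)$ for all $z\in\mathbb{D}$.
   Context: $\mathbb{D}=\{z\in\mathbb{C}:|z|<1\}$ is the unit disk. Strongly spirallike functions: let $\lambda\in(-\pi/2,\pi/2)$ and $\alpha\in(0,1)$. An analytic function $f$ on $\mathbb{D}$ is called strongly $\lambda$-spirallike of order $\alpha$ if $f(0)=0$, $f'(0)\neq 0$, and $$\left|\arg\frac{zf'(z)}{f(z)}-\lambda\right|<\frac{\pi\alpha}{2},\qquad z\in\mathbb{D}.$$ Here $zf'(z)/f(z)$ is understood to have the value $1$ at $z=0$ and the condition includes that $f(z)\ne 0$ for $0<|z|<1$; it means that $zf'(z)/f(z)$ lies in the open sector $\{se^{i\phi}: s>0,\ |\phi-\lambda|<\pi\alpha/2\}$ for every $z\in\mathbb{D}$. Since the value $1$ is assumed at $z=0$, necessarily $|\lambda|<\pi\alpha/2$. The function $f$ is called strongly spirallike of order $\alpha$ if it is strongly $\lambda$-spirallike of order $\alpha$ for some such $\lambda$. Quasiconformality: for $0\le k<1$, a homeomorphism $F:\mathbb{C}\to\mathbb{C}$ is called $k$-quasiconformal if $F$ has locally integrable partial derivatives on $\mathbb{C}$ (in the sense of distributions) which satisfy $|\partial_{\bar z}F|\le k|\partial_z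 F|$ a.e. *)

theory Defs
  imports "HOL-Complex_Analysis.Complex_Analysis"
begin

definition open_sector :: "real \<Rightarrow> real \<Rightarrow> complex set" where
  "open_sector lam \<delta> = {of_real s * cis \<phi> | s \<phi>. 0 < s \<and> \<bar>\<phi> - lam\<bar> < \<delta>}"

text \<open>
  At the origin the removable singularity of \<open>z f'(z) / f(z)\<close> is filled with the value 1, so
  the sector condition at \<open>z = 0\<close> amounts to \<open>\<bar>lam\<bar> < \<pi>\<alpha>/2\<close>.
\<close>

definition strongly_spirallike_at :: "real \<Rightarrow> real \<Rightarrow> (complex \<Rightarrow> complex) \<Rightarrow> bool" where
  "strongly_spirallike_at lam \<alpha> f \<longleftrightarrow>
     f analytic_on ball 0 1 \<and> f 0 = 0 \<and> deriv f 0 \<noteq> 0 \<and>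
     (\<forall>z\<in>ball 0 1 - {0}. f z \<noteq> 0) \<and>
     (\<forall>z\<in>ball 0 1. (if z = 0 then 1 else z * deriv f z / f z) \<in> open_sector lam (pi * \<alpha> / 2))"

definition strongly_spirallike :: "real \<Rightarrow> (complex \<Rightarrow> complex) \<Rightarrow> bool" where
  "strongly_spirallike \<alpha> f \<longleftrightarrow> (\<exists>lam. - pi / 2 < lam \<and> lam < pi / 2 \<and> strongly_spirallike_at lam \<alpha> f)"

primrec Ck :: "nat \<Rightarrow> ('a::euclidean_space \<Rightarrow> real) \<Rightarrow> bool" where
  "Ck 0 \<phi> \<longleftrightarrow> continuous_on UNIV \<phi>"
| "Ck (Suc n) \<phi> \<longleftrightarrow>
     \<phi> differentiable_on UNIV \<and> (\<forall>v. Ck n (\<lambda>x. frechet_derivative \<phi> (at x) v))"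

definition test_function :: "('a::euclidean_space \<Rightarrow> real) \<Rightarrow> bool" where
  "test_function \<phi> \<longleftrightarrow> (\<forall>n. Ck n \<phi>) \<and> compact (closure {x. \<phi> x \<noteq> 0})"

definition locally_integrable :: "('a::euclidean_space \<Rightarrow> 'b::euclidean_space) \<Rightarrow> bool" where
  "locally_integrable g \<longleftrightarrow> (\<forall>K. compact K \<longrightarrow> g absolutely_integrable_on K)"

text \<open>
  \<open>g\<close> represents the distributional derivative of \<open>F\<close> in the direction \<open>v\<close>. On the complex plane
  the directions \<open>1\<close> and \<open>\<i>\<close> give \<open>\<partial>/\<partial>x\<close> and \<open>\<partial>/\<partial>y\<close>.
\<close>

definition weak_directional_derivative ::
    "'a::euclidean_space \<Rightarrow> ('a \<Rightarrow> 'b::euclidean_space) \<Rightarrow> ('a \<Rightarrow> 'b) \<Rightarrow> bool" where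
  "weak_directional_derivative v F g \<longleftrightarrow>
     locally_integrable F \<and> locally_integrable g \<and>
     (\<forall>\<phi>. test_function \<phi> \<longrightarrow>
        (LINT x|lebesgue. frechet_derivative \<phi> (at x) v *\<^sub>R F x) =
        - (LINT x|lebesgue. \<phi> x *\<^sub>R g x))"

text \<open>
  The Wirtinger derivatives are \<open>\<partial>F/\<partial>z = (F\<^sub>x - \<i> F\<^sub>y) / 2\<close> and \<open>\<partial>F/\<partial>(cnj z) = (F\<^sub>x + \<i> F\<^sub>y) / 2\<close>.
\<close>

definition quasiconformal :: "real \<Rightarrow> (complex \<Rightarrow> complex) \<Rightarrow> bool" where
  "quasiconformal k F \<longleftrightarrow>
     0 \<le> k \<and> k < 1 \<and> (\<exists>G. homeomorphism UNIV UNIV F G) \<and>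
     (\<exists>Fx Fy. weak_directional_derivative 1 F Fx \<and> weak_directional_derivative \<i> F Fy \<and>
        (AE z in lebesgue. cmod ((Fx z + \<i> * Fy z) / 2) \<le> k * cmod ((Fx z - \<i> * Fy z) / 2)))"

end

theory Submission
  imports Defs
begin

text \<open>
  Write \<open>f z = z * exp (Q z)\<close> and pass to the coordinate \<open>z = exp \<zeta>\<close>, turned by the spiral angle:
  \<open>h \<zeta> = cis (- lam) * (\<zeta> + Q (exp \<zeta>))\<close> is a map of the left half-plane whose derivative
  \<open>cis (- lam) * (z * deriv f z / f z)\<close> stays in the sector of half-angle \<open>\<beta> = pi * \<alpha> / 2\<close> about the
  positive axis. Comparing the sector with a half-plane, the Schwarz lemma bounds the derivative by
  a constant times \<open>(1 - cmod z) powr (- \<alpha>)\<close>. This is integrable along radii, so that \<open>Q\<close> and \<open>h\<close>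
  extend continuously to the boundary (\<open>strongly_spirallike_representation\<close>). By the sector condition
  the boundary of the image of \<open>h\<close> is a graph \<open>Re w = \<rho> (Im w)\<close> with Lipschitz constant \<open>tan \<beta>\<close>, and
  \<open>h\<close> maps into the region to the left of it (\<open>below_bd\<close>).

  The horizontal reflection \<open>(u, v) \<mapsto> (2 * \<rho> v - u, v)\<close> in this graph would have dilatation
  \<open>sin \<beta>\<close>, but it is only as smooth as \<open>\<rho>\<close>. It is therefore replaced by a reflection that exchanges
  the curves \<open>u = P v e - e\<close> and \<open>u = P v e + e\<close>, where \<open>P v e\<close> is the mean of \<open>\<rho>\<close> over the interval
  with centre \<open>v\<close> and radius \<open>cos \<beta> * e\<close>. This one is differentiable off the graph, and with \<open>a\<close>
  and \<open>b\<close> the partial derivatives of \<open>P\<close> in \<open>v\<close> and \<open>e\<close> its dilatation is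
  \<open>sqrt ((a\<^sup>2 + b\<^sup>2) / (1 + a\<^sup>2))\<close>. The trapezoidal rule gives
  \<open>\<bar>b\<bar> \<le> cos \<beta> * ((tan \<beta>)\<^sup>2 - a\<^sup>2) / (2 * tan \<beta>)\<close>, so nothing is lost by the averaging: the dilatation
  is still at most \<open>sin \<beta>\<close> (\<open>beltrami_avg\<close>, \<open>reflect_has_derivative\<close>).

  Reflecting \<open>h\<close> across the imaginary axis gives a map \<open>H\<close> of the plane (\<open>extension\<close>), and
  \<open>F (exp \<zeta>) = exp (cis lam * H \<zeta>)\<close> defines the extension of \<open>f\<close>. It is injective, continuous and
  proper, hence a homeomorphism by invariance of domain. It is differentiable off the unit
  circle, where it satisfies the Beltrami inequality, and its derivative is bounded there by a local
  constant times \<open>\<bar>cmod z - 1\<bar> powr (- \<alpha>)\<close>. This power is locally integrable, and integration by parts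
  on lines, each of which meets the circle in at most two points, identifies the pointwise
  derivatives with the weak ones (\<open>weak_directional_derivative_off_circle\<close>).
\<close>

section \<open>Weak derivatives across the unit circle\<close>

lemma emeasure_annulus_le:
  fixes x :: real
  assumes "0 \<le> x" "x \<le> 1"
  shows "emeasure lborel {z::complex. \<bar>cmod z - 1\<bar> \<le> x} \<le> ennreal (4 * pi * x)"
proof -
  have "{z::complex. \<bar>cmod z - 1\<bar> \<le> x} = cball 0 (1 + x) - ball 0 (1 - x)"
    by auto
  then have "emeasure lborel {z::complex. \<bar>cmod z - 1\<bar> \<le> x} =
      emeasure lborel (cball 0 (1 + x) :: complex set) - emeasure lborel (ball 0 (1 - x) :: complex set)"
    using assms by (simp add: emeasure_Diff emeasure_ball subset_iff)
  also have "\<dots> = ennreal (pi * (1 + x)\<^sup>2 - pi * (1 - x)\<^sup>2)"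
    using assms by (simp add: emeasure_ball emeasure_cball unit_ball_vol_2 ennreal_minus)
  also have "pi * (1 + x)\<^sup>2 - pi * (1 - x)\<^sup>2 = 4 * pi * x"
    by (simp add: power2_eq_square algebra_simps)
  finally show ?thesis by simp
qed

lemma dyadic_bracket:
  fixes d :: real
  assumes "0 < d" "d \<le> 1"
  obtains n :: nat where "d \<le> (1/2) ^ n" "(1/2) ^ Suc n < d"
proof -
  obtain m where m: "(1/2::real) ^ m < d"
    using real_arch_pow_inv[of d "1/2"] assms by auto
  define N where "N = (LEAST m. (1/2::real) ^ m < d)"
  have N: "(1/2::real) ^ N < d" unfolding N_def by (rule LeastI[of _ m]) (rule m)
  then obtain n where n: "N = Suc n" using assms by (cases N) auto
  have "\<not> (1/2::real) ^ n < d"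
    using not_less_Least[of n "\<lambda>m. (1/2::real) ^ m < d"] n N_def by simp
  with N n show thesis by (intro that[of n]) auto
qed

text \<open>
  The annuli \<open>{z. \<bar>cmod z - 1\<bar> \<le> 2 powr (- n)}\<close> have area of order \<open>2 powr (- n)\<close>, while the
  integrand is at most of order \<open>2 powr (a * n)\<close> outside the next one; the resulting series is
  geometric with ratio \<open>2 powr (a - 1)\<close>.
\<close>
lemma integrable_dist_circle_powr:
  fixes a R :: real
  assumes "0 < a" "a < 1"
  shows "integrable lborel (\<lambda>z::complex. indicator (cball 0 R) z * \<bar>cmod z - 1\<bar> powr (- a))"
proof (rule integrableI_bounded)
  show "(\<lambda>z::complex. indicator (cball 0 R) z * \<bar>cmod z - 1\<bar> powr (- a)) \<in> borel_measurable lborel"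
  proof (intro borel_measurable_times borel_measurable_indicator measurable_abs_powr)
    show "(\<lambda>z::complex. cmod z - 1) \<in> borel_measurable lborel" by measurable
  qed auto
  define B where "B n = {z::complex. \<bar>cmod z - 1\<bar> \<le> (1/2) ^ n}" for n :: nat
  define c where "c n = 2 powr (a * real (Suc n))" for n
  have [measurable]: "B n \<in> sets lborel" for n unfolding B_def by measurable
  have pw: "ennreal (norm (indicator (cball 0 R) z * \<bar>cmod z - 1\<bar> powr (- a)))
      \<le> indicator (cball 0 R) z + (\<Sum>n. ennreal (c n) * indicator (B n) z)" for z :: complex
  proof (cases "cmod z = 1")
    case True then show ?thesis by simp
  next
    case False
    define d where "d = \<bar>cmod z - 1\<bar>"
    have d: "d > 0" using False by (simp add: d_def)
    show ?thesis
    proof (cases "d \<le> 1")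
      case True
      obtain n :: nat where n: "d \<le> (1/2) ^ n" "(1/2) ^ Suc n < d"
        using dyadic_bracket[OF d True] by blast
      have "d powr (- a) \<le> ((1/2) ^ Suc n) powr (- a)"
        using n(2) assms by (intro powr_mono2') auto
      also have "((1/2::real) ^ Suc n) = 2 powr (- real (Suc n))"
        by (simp only: powr_minus powr_realpow[OF zero_less_numeral] power_one_over)
           (simp add: field_simps)
      also have "\<dots> powr (- a) = c n" by (simp add: powr_powr c_def algebra_simps)
      finally have le: "d powr (- a) \<le> c n" .
      have "ennreal (norm (indicator (cball 0 R) z * \<bar>cmod z - 1\<bar> powr (- a))) \<le> ennreal (d powr (-a))"
        by (intro ennreal_leI) (auto simp: d_def indicator_def)
      also have "\<dots> \<le> ennreal (c n) * indicator (B n) z"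
        using le n(1) by (simp add: B_def d_def ennreal_leI)
      also have "\<dots> \<le> (\<Sum>n. ennreal (c n) * indicator (B n) z)"
      proof -
        have "g n \<le> suminf g" for g :: "nat \<Rightarrow> ennreal"
          using sum_le_suminf[of g "{n}"] by simp
        then show ?thesis .
      qed
      finally show ?thesis by (simp add: add_increasing)
    next
      case False
      then have "d powr (- a) \<le> d powr 0" using assms by (intro powr_mono) auto
      then have "d powr (- a) \<le> 1" using d by simp
      then have "ennreal (norm (indicator (cball 0 R) z * \<bar>cmod z - 1\<bar> powr (- a))) \<le> indicator (cball 0 R) z"
        by (auto simp: d_def indicator_def)
      then show ?thesis by (simp add: add_increasing2)
    qed
  qed
  have "(\<integral>\<^sup>+ z. ennreal (norm (indicator (cball 0 R) z * \<bar>cmod z - 1\<bar> powr (- a))) \<partial>lborel)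
     \<le> (\<integral>\<^sup>+ z. (indicator (cball 0 R :: complex set) z + (\<Sum>n. ennreal (c n) * indicator (B n) z)) \<partial>lborel)"
    by (intro nn_integral_mono pw)
  also have "\<dots> = emeasure lborel (cball 0 R :: complex set) + (\<Sum>n. ennreal (c n) * emeasure lborel (B n))"
  proof (subst nn_integral_add)
    have "(\<integral>\<^sup>+ z. (\<Sum>n. ennreal (c n) * indicator (B n) z) \<partial>lborel)
        = (\<Sum>n. \<integral>\<^sup>+ z. ennreal (c n) * indicator (B n) z \<partial>lborel)"
      by (rule nn_integral_suminf) measurable
    also have "\<dots> = (\<Sum>n. ennreal (c n) * emeasure lborel (B n))"
      by (intro suminf_cong nn_integral_cmult_indicator) measurable
    finally show "(\<integral>\<^sup>+ z. indicator (cball 0 R :: complex set) z \<partial>lborel)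
        + (\<integral>\<^sup>+ z. (\<Sum>n. ennreal (c n) * indicator (B n) z) \<partial>lborel)
        = emeasure lborel (cball 0 R :: complex set) + (\<Sum>n. ennreal (c n) * emeasure lborel (B n))"
      by simp
    show "(\<lambda>z. indicator (cball 0 R) z) \<in> borel_measurable (lborel :: complex measure)"
      by (intro borel_measurable_indicator) auto
    show "(\<lambda>z. \<Sum>n. ennreal (c n) * indicator (B n) z) \<in> borel_measurable lborel" by measurable
  qed
  also have "(\<Sum>n. ennreal (c n) * emeasure lborel (B n)) \<le> (\<Sum>n. ennreal (c n * (4 * pi * (1/2) ^ n)))"
  proof (intro suminf_le allI)
    show "ennreal (c n) * emeasure lborel (B n) \<le> ennreal (c n * (4 * pi * (1/2) ^ n))" for n
      using emeasure_annulus_le[of "(1/2) ^ n"]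
      by (simp add: B_def c_def ennreal_mult'' mult_left_mono power_le_one)
  qed auto
  also have "(\<lambda>n. c n * (4 * pi * (1/2) ^ n)) = (\<lambda>n. 4 * pi * 2 powr a * (2 powr a / 2) ^ n)"
    unfolding c_def
    by (simp add: fun_eq_iff power_divide powr_add distrib_left powr_powr[symmetric] powr_realpow)
  also have "(\<Sum>n. ennreal (4 * pi * 2 powr a * (2 powr a / 2) ^ n)) \<noteq> top"
  proof (rule ennreal_suminf_neq_top)
    have "2 powr a < 2 powr (1::real)" using assms by (intro powr_less_mono) auto
    then show "summable (\<lambda>n. 4 * pi * 2 powr a * (2 powr a / 2) ^ n)"
      by (intro summable_mult summable_geometric) auto
  qed auto
  then have "emeasure lborel (cball 0 R :: complex set) + (\<Sum>n. ennreal (4 * pi * 2 powr a * (2 powr a / 2) ^ n)) < \<infinity>"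
    using emeasure_bounded_finite[of "cball 0 R :: complex set"] by (simp add: top.not_eq_extremum)
  finally show "(\<integral>\<^sup>+ z. ennreal (norm (indicator (cball 0 R) z * \<bar>cmod z - 1\<bar> powr (- a))) \<partial>lborel) < \<infinity>"
    by (simp add: add_left_mono order.strict_trans1)
qed

text \<open>
  Lebesgue measure on the complex plane as a product measure. The inner variable \<open>x\<close> runs in the
  direction \<open>v\<close> of differentiation, so both coordinate directions are covered.
\<close>
lemma lborel_complex_distr:
  assumes "(v, w) = (1, \<i>) \<or> (v, w) = (\<i>, 1)"
  shows "lborel = distr (lborel \<Otimes>\<^sub>M lborel) borel (\<lambda>(y::real, x::real). of_real x * v + of_real y * w)"
proof (rule lborel_eqI)
  have meas: "(\<lambda>(y::real, x::real). of_real x * v + of_real y * w) \<in> lborel \<Otimes>\<^sub>M lborel \<rightarrow>\<^sub>M borel"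
  proof -
    have "continuous_on UNIV (\<lambda>p::real \<times> real. of_real (snd p) * v + of_real (fst p) * w)"
      by (intro continuous_intros)
    then show ?thesis
      using borel_measurable_continuous_onI[of "\<lambda>p::real \<times> real. of_real (snd p) * v + of_real (fst p) * w"]
      by (simp add: lborel_prod case_prod_beta)
  qed
  fix l u :: complex
  assume le: "\<And>b. b \<in> Basis \<Longrightarrow> l \<bullet> b \<le> u \<bullet> b"
  then have le': "Re l \<le> Re u" "Im l \<le> Im u"
    using le[of 1] le[of \<i>] by (simp_all add: Basis_complex_def inner_complex_def)
  have bx: "z \<in> box l u \<longleftrightarrow> Re l < Re z \<and> Re z < Re u \<and> Im l < Im z \<and> Im z < Im u" for z
    by (auto simp: box_def Basis_complex_def inner_complex_def)
  have "(\<lambda>(y::real, x::real). of_real x * v + of_real y * w) -` box l u =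
     (if v = 1 then {Im l<..<Im u} \<times> {Re l<..<Re u} else {Re l<..<Re u} \<times> {Im l<..<Im u})"
    using assms by (auto simp: bx)
  then show "emeasure (distr (lborel \<Otimes>\<^sub>M lborel) borel (\<lambda>(y, x). of_real x * v + of_real y * w)) (box l u)
      = (\<Prod>b\<in>Basis. (u - l) \<bullet> b)"
    using le'
    by (subst emeasure_distr[OF meas])
       (auto simp: space_pair_measure lborel.emeasure_pair_measure_Times Basis_complex_def
          ennreal_mult'[symmetric] mult.commute)
qed simp

lemma finite_line_circle:
  assumes "(v, w) = (1, \<i>) \<or> (v, w) = (\<i>, 1)"
  shows "finite {x::real. cmod (of_real x * v + of_real y * w) = 1}"
proof (rule finite_subset)
  show "{x::real. cmod (of_real x * v + of_real y * w) = 1} \<subseteq> {sqrt (1 - y\<^sup>2), - sqrt (1 - y\<^sup>2)}"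
  proof
    fix x :: real assume "x \<in> {x. cmod (of_real x * v + of_real y * w) = 1}"
    then have "x\<^sup>2 + y\<^sup>2 = 1"
      using assms by (auto simp: cmod_def add.commute)
    then have "sqrt (1 - y\<^sup>2) = \<bar>x\<bar>" by (metis add_diff_cancel_right' real_sqrt_abs)
    then show "x \<in> {sqrt (1 - y\<^sup>2), - sqrt (1 - y\<^sup>2)}" by auto
  qed
qed simp

text \<open>
  Integration by parts across the unit circle: every line parallel to a coordinate axis meets the
  circle in at most two points, and the fundamental theorem of calculus tolerates them because
  the function is continuous there.
\<close>
lemma integral_directional_derivative_eq_0:
  fixes \<psi> \<eta> :: "complex \<Rightarrow> complex"
  assumes vw: "(v, w) = (1, \<i>) \<or> (v, w) = (\<i>, 1)"
    and cont: "continuous_on UNIV \<psi>"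
    and der: "\<And>z. cmod z \<noteq> 1 \<Longrightarrow> ((\<lambda>t. \<psi> (z + of_real t * v)) has_vector_derivative \<eta> z) (at 0)"
    and supp: "\<And>z. R \<le> cmod z \<Longrightarrow> \<psi> z = 0 \<and> \<eta> z = 0"
    and int: "integrable lborel \<eta>"
  shows "integral\<^sup>L lborel \<eta> = 0"
proof -
  let ?T = "\<lambda>(y::real, x::real). of_real x * v + of_real y * w"
  have eq: "lborel = distr (lborel \<Otimes>\<^sub>M lborel) borel ?T" using lborel_complex_distr[OF vw] .
  have meas[measurable]: "?T \<in> lborel \<Otimes>\<^sub>M lborel \<rightarrow>\<^sub>M borel"
  proof -
    have "continuous_on UNIV (\<lambda>p::real \<times> real. of_real (snd p) * v + of_real (fst p) * w)"
      by (intro continuous_intros)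
    then show ?thesis
      using borel_measurable_continuous_onI[of "\<lambda>p::real \<times> real. of_real (snd p) * v + of_real (fst p) * w"]
      by (simp add: lborel_prod case_prod_beta)
  qed
  have [measurable]: "\<eta> \<in> borel_measurable borel" using int by auto
  have int2: "integrable (lborel \<Otimes>\<^sub>M lborel) (\<lambda>p. \<eta> (?T p))"
    using int by (subst (asm) eq) (simp add: integrable_distr_eq)
  have inner: "(LINT x|lborel. \<eta> (of_real x * v + of_real y * w)) = 0" for y :: real
  \<comment> \<open>On the exceptional lines where the restriction is not integrable, the Bochner integral
    is 0 by convention.\<close>
  proof (cases "integrable lborel (\<lambda>x. \<eta> (of_real x * v + of_real y * w))")
    case True
    have v1: "cmod v = 1" using vw by auto
    define r where "r = \<bar>R\<bar> + 1"
    have big: "R \<le> cmod (of_real x * v + of_real y * w)" if "\<bar>x\<bar> \<ge> r" for x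
    proof -
      have "\<bar>x\<bar> \<le> cmod (of_real x * v + of_real y * w)"
        using vw abs_Re_le_cmod[of "of_real x * v + of_real y * w"]
          abs_Im_le_cmod[of "of_real x * v + of_real y * w"] by auto
      then show ?thesis using that by (simp add: r_def)
    qed
    have "((\<lambda>x. \<eta> (of_real x * v + of_real y * w)) has_integral
        (\<psi> (of_real r * v + of_real y * w) - \<psi> (of_real (-r) * v + of_real y * w))) {-r..r}"
    proof (rule fundamental_theorem_of_calculus_interior_strong[OF finite_line_circle[OF vw, of y]])
      show "- r \<le> r" by (simp add: r_def)
      fix x assume "x \<in> {- r<..<r} - {x. cmod (of_real x * v + of_real y * w) = 1}"
      then have "((\<lambda>t. \<psi> (of_real x * v + of_real y * w + of_real t * v)) has_vector_derivative
           \<eta> (of_real x * v + of_real y * w)) (at 0)"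
        by (intro der) auto
      moreover have "(\<lambda>t. \<psi> (of_real x * v + of_real y * w + of_real t * v))
           = (\<lambda>s. \<psi> (of_real s * v + of_real y * w)) \<circ> (\<lambda>t. x + t)"
        by (auto simp: fun_eq_iff algebra_simps)
      ultimately have *: "((\<lambda>s. \<psi> (of_real s * v + of_real y * w)) \<circ> (\<lambda>t. x + t) has_vector_derivative
           \<eta> (of_real x * v + of_real y * w)) (at 0)" by simp
      have "(((\<lambda>s. \<psi> (of_real s * v + of_real y * w)) \<circ> (\<lambda>t. x + t)) \<circ> (\<lambda>s. s - x) has_vector_derivative
           1 *\<^sub>R \<eta> (of_real x * v + of_real y * w)) (at x)"
        by (rule vector_diff_chain_at)
           (use * in \<open>auto intro!: derivative_eq_intros\<close>)
      then show "((\<lambda>x. \<psi> (of_real x * v + of_real y * w)) has_vector_derivative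
           \<eta> (of_real x * v + of_real y * w)) (at x)"
        by (simp add: o_def)
    next
      show "continuous_on {- r..r} (\<lambda>x. \<psi> (of_real x * v + of_real y * w))"
        by (intro continuous_on_compose2[OF cont] continuous_intros) auto
    qed
    moreover have "\<psi> (of_real r * v + of_real y * w) = 0" "\<psi> (of_real (-r) * v + of_real y * w) = 0"
      using supp big[of r] big[of "-r"] by (auto simp: r_def)
    ultimately have "((\<lambda>x. \<eta> (of_real x * v + of_real y * w)) has_integral 0) {-r..r}" by simp
    then have "((\<lambda>x. \<eta> (of_real x * v + of_real y * w)) has_integral 0) UNIV"
    proof (rule has_integral_on_superset)
      show "\<eta> (of_real x * v + of_real y * w) = 0" if "x \<notin> {- r..r}" for x
        using supp big[of x] that by auto
    qed simp
    with has_integral_integral_lborel[OF True] show ?thesis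
      by (rule has_integral_unique)
  qed (simp add: not_integrable_integral_eq)
  have "integral\<^sup>L lborel \<eta> = integral\<^sup>L (lborel \<Otimes>\<^sub>M lborel) (\<lambda>p. \<eta> (?T p))"
    by (subst eq) (simp add: integral_distr)
  also have "\<dots> = (LINT y|lborel. LINT x|lborel. \<eta> (?T (y, x)))"
    by (rule lborel_pair.integral_fst'[OF int2, symmetric])
  also have "\<dots> = 0" using inner by simp
  finally show ?thesis .
qed

text \<open>
  The derivative is the pointwise limit of difference quotients, which are continuous in the
  base point.
\<close>
lemma borel_measurable_directional_derivative:
  fixes F D :: "complex \<Rightarrow> complex"
  assumes cont: "continuous_on UNIV F"
    and der: "\<And>z. cmod z \<noteq> 1 \<Longrightarrow> ((\<lambda>t. F (z + of_real t * v)) has_vector_derivative D z) (at 0)"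
    and D0: "\<And>z. cmod z = 1 \<Longrightarrow> D z = 0"
  shows "D \<in> borel_measurable borel"
proof -
  define S where "S = {z::complex. cmod z \<noteq> 1}"
  have [measurable]: "S \<in> sets borel" unfolding S_def by measurable
  define G where "G n z = indicat_real S z *\<^sub>R ((F (z + of_real (inverse (real (Suc n))) * v) - F z) /\<^sub>R inverse (real (Suc n)))"
    for n z
  have [measurable]: "F \<in> borel_measurable borel" using cont by (rule borel_measurable_continuous_onI)
  have [measurable]: "(\<lambda>z. F (z + of_real (inverse (real (Suc n))) * v)) \<in> borel_measurable borel" for n
    by (intro borel_measurable_continuous_onI continuous_on_compose2[OF cont] continuous_intros) auto
  show ?thesis
  proof (rule borel_measurable_LIMSEQ_metric)
    show "G n \<in> borel_measurable borel" for n unfolding G_def by measurable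
    show "(\<lambda>n. G n z) \<longlonglongrightarrow> D z" for z
    proof (cases "cmod z = 1")
      case True then show ?thesis by (simp add: G_def S_def D0)
    next
      case False
      have "((\<lambda>t. (F (z + of_real t * v) - F z) /\<^sub>R t) \<longlongrightarrow> D z) (at 0)"
      proof (rule LIM_zero_cancel, rule tendsto_norm_zero_cancel)
        have "((\<lambda>t. norm (F (z + of_real t * v) - F z - t *\<^sub>R D z) / norm t) \<longlongrightarrow> 0) (at 0)"
          using der[OF False] by (simp add: has_vector_derivative_def has_derivative_at)
        then show "((\<lambda>t. norm ((F (z + of_real t * v) - F z) /\<^sub>R t - D z)) \<longlongrightarrow> 0) (at 0)"
        proof (rule Lim_transform_eventually)
          show "\<forall>\<^sub>F t in at 0. norm (F (z + of_real t * v) - F z - t *\<^sub>R D z) / norm t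
              = norm ((F (z + of_real t * v) - F z) /\<^sub>R t - D z)"
          proof (rule eventually_at_topological[THEN iffD2], intro exI[of _ UNIV] conjI ballI impI)
            fix t :: real assume "t \<noteq> 0"
            then have "(F (z + of_real t * v) - F z) /\<^sub>R t - D z = (F (z + of_real t * v) - F z - t *\<^sub>R D z) /\<^sub>R t"
              by (simp add: scaleR_diff_right)
            then show "norm (F (z + of_real t * v) - F z - t *\<^sub>R D z) / norm t
              = norm ((F (z + of_real t * v) - F z) /\<^sub>R t - D z)"
              by (simp add: divide_inverse mult.commute)
          qed auto
        qed
      qed
      moreover have "filterlim (\<lambda>n. inverse (real (Suc n))) (at 0) sequentially"
        using LIMSEQ_inverse_real_of_nat by (auto simp: filterlim_at simp del: of_nat_Suc)
      ultimately have "(\<lambda>n. (F (z + of_real (inverse (real (Suc n))) * v) - F z) /\<^sub>R inverse (real (Suc n))) \<longlonglongrightarrow> D z"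
        by (rule filterlim_compose)
      with False show ?thesis by (simp add: G_def S_def)
    qed
  qed
qed

text \<open>
  A continuous function that is differentiable in the direction \<open>v\<close> off the unit circle has its
  pointwise derivative as weak derivative as soon as that derivative does not blow up faster than
  an integrable power of the distance to the circle.
\<close>
lemma weak_directional_derivative_off_circle:
  fixes F D :: "complex \<Rightarrow> complex"
  assumes v: "v = 1 \<or> v = \<i>"
    and cont: "continuous_on UNIV F"
    and der: "\<And>z. cmod z \<noteq> 1 \<Longrightarrow> ((\<lambda>t. F (z + of_real t * v)) has_vector_derivative D z) (at 0)"
    and a: "0 < a" "a < 1"
    and bound: "\<And>R. \<exists>M. \<forall>z. cmod z \<le> R \<longrightarrow> norm (D z) \<le> M * \<bar>cmod z - 1\<bar> powr (- a)"
  shows "weak_directional_derivative v F D"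
proof -
  \<comment> \<open>The bound forces the value 0 on the circle, because \<open>0 powr (- a) = 0\<close>.\<close>
  have D0: "D z = 0" if "cmod z = 1" for z
  proof -
    obtain M where "\<forall>z. cmod z \<le> 1 \<longrightarrow> norm (D z) \<le> M * \<bar>cmod z - 1\<bar> powr (- a)"
      using bound by blast
    from this[rule_format, of z] that show ?thesis by simp
  qed
  have Dm[measurable]: "D \<in> borel_measurable borel"
    using borel_measurable_directional_derivative[OF cont der D0] by simp
  have Fm[measurable]: "F \<in> borel_measurable borel"
    using cont by (rule borel_measurable_continuous_onI)
  have intD: "integrable lborel (\<lambda>z. indicat_real (cball 0 R) z *\<^sub>R D z)" for R
  proof -
    obtain M where M: "\<And>z. cmod z \<le> R \<Longrightarrow> norm (D z) \<le> M * \<bar>cmod z - 1\<bar> powr (- a)"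
      using bound by blast
    show ?thesis
    proof (rule Bochner_Integration.integrable_bound)
      show "integrable lborel (\<lambda>z::complex. M * (indicator (cball 0 R) z * \<bar>cmod z - 1\<bar> powr (- a)))"
        using integrable_dist_circle_powr[OF a] by simp
      show "AE z in lborel. norm (indicat_real (cball 0 R) z *\<^sub>R D z)
          \<le> norm (M * (indicat_real (cball 0 R) z * \<bar>cmod z - 1\<bar> powr (- a)))"
      proof (intro AE_I2)
        fix z show "norm (indicat_real (cball 0 R) z *\<^sub>R D z)
          \<le> norm (M * (indicat_real (cball 0 R) z * \<bar>cmod z - 1\<bar> powr (- a)))"
        proof (cases "cmod z \<le> R")
          case True
          then show ?thesis using M[of z] abs_ge_self[of "M * \<bar>cmod z - 1\<bar> powr (- a)"]
            by (simp add: abs_mult)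
        qed auto
      qed
    next
      have "indicat_real (cball 0 R) \<in> borel_measurable (lborel :: complex measure)"
        by (intro borel_measurable_indicator) auto
      then show "(\<lambda>z. indicat_real (cball 0 R) z *\<^sub>R D z) \<in> borel_measurable lborel"
        by (rule borel_measurable_scaleR) simp
    qed
  qed
  have locF: "locally_integrable F"
    unfolding locally_integrable_def
  proof (intro allI impI)
    fix K :: "complex set" assume K: "compact K"
    have "integrable lborel (\<lambda>z. indicat_real K z *\<^sub>R F z)"
      by (rule borel_integrable_compact[OF K continuous_on_subset[OF cont]]) simp
    then show "F absolutely_integrable_on K"
      by (simp add: set_integrable_def integrable_completion)
  qed
  have locD: "locally_integrable D"
    unfolding locally_integrable_def
  proof (intro allI impI)
    fix K :: "complex set" assume K: "compact K"
    then obtain R where R: "K \<subseteq> cball 0 R"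
      using bounded_subset_ballD[OF compact_imp_bounded[OF K], of 0] ball_subset_cball by (meson subset_trans)
    have "set_integrable lebesgue (cball 0 R) D"
      using intD[of R] by (simp add: set_integrable_def integrable_completion)
    then show "D absolutely_integrable_on K"
      by (rule set_integrable_subset) (use R K in \<open>auto simp: borel_compact\<close>)
  qed
  have parts: "(LINT x|lebesgue. frechet_derivative \<phi> (at x) v *\<^sub>R F x) = - (LINT x|lebesgue. \<phi> x *\<^sub>R D x)"
    if \<phi>: "test_function \<phi>" for \<phi>
  proof -
    have "Ck (Suc 0) \<phi>" using \<phi> unfolding test_function_def by blast
    then have dif: "\<And>x. \<phi> differentiable (at x)"
      and c\<phi>': "continuous_on UNIV (\<lambda>x. frechet_derivative \<phi> (at x) v)"
      by (auto simp: differentiable_on_def)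
    have c\<phi>: "continuous_on UNIV \<phi>"
      using dif by (simp add: continuous_on_eq_continuous_at differentiable_imp_continuous_within)
    obtain R where R: "closure {x. \<phi> x \<noteq> 0} \<subseteq> ball 0 R"
      using \<phi> bounded_subset_ballD[of "closure {x. \<phi> x \<noteq> 0}" 0]
      by (metis compact_imp_bounded test_function_def)
    have \<phi>0: "\<phi> z = 0" if "R \<le> cmod z" for z
      using R that closure_subset[of "{x. \<phi> x \<noteq> 0}"] by (auto simp: subset_iff)
    have \<phi>'0: "frechet_derivative \<phi> (at z) v = 0" if "R \<le> cmod z" for z
    proof -
      have "((\<lambda>_. 0) has_derivative (\<lambda>_. 0)) (at z)" by simp
      then have "(\<phi> has_derivative (\<lambda>_. 0)) (at z)"
      proof (rule has_derivative_transform_within_open)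
        show "open (- closure {x. \<phi> x \<noteq> 0})" by (rule open_Compl[OF closed_closure])
        show "z \<in> - closure {x. \<phi> x \<noteq> 0}" using R that by auto
        show "0 = \<phi> x" if "x \<in> - closure {x. \<phi> x \<noteq> 0}" for x
          using that closure_subset[of "{x. \<phi> x \<noteq> 0}"] by auto
      qed
      then show ?thesis by (metis frechet_derivative_at)
    qed
    let ?\<eta> = "\<lambda>z. frechet_derivative \<phi> (at z) v *\<^sub>R F z + \<phi> z *\<^sub>R D z"
    have [measurable]: "\<phi> \<in> borel_measurable borel" "(\<lambda>x. frechet_derivative \<phi> (at x) v) \<in> borel_measurable borel"
      using c\<phi> c\<phi>' by (auto intro: borel_measurable_continuous_onI)
    have i1: "integrable lborel (\<lambda>z. frechet_derivative \<phi> (at z) v *\<^sub>R F z)"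
    proof -
      have "integrable lborel (\<lambda>z. indicat_real (cball 0 R) z *\<^sub>R (frechet_derivative \<phi> (at z) v *\<^sub>R F z))"
        by (rule borel_integrable_compact)
           (auto intro!: continuous_intros continuous_on_subset[OF c\<phi>'] continuous_on_subset[OF cont])
      moreover have "(\<lambda>z. indicat_real (cball 0 R) z *\<^sub>R (frechet_derivative \<phi> (at z) v *\<^sub>R F z))
          = (\<lambda>z. frechet_derivative \<phi> (at z) v *\<^sub>R F z)"
        using \<phi>'0 by (force simp: fun_eq_iff indicator_def)
      ultimately show ?thesis by simp
    qed
    have i2: "integrable lborel (\<lambda>z. \<phi> z *\<^sub>R D z)"
    proof -
      have "compact (\<phi> ` cball 0 R)"
        by (intro compact_continuous_image continuous_on_subset[OF c\<phi>]) auto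
      then obtain B where B: "\<And>z. cmod z \<le> R \<Longrightarrow> \<bar>\<phi> z\<bar> \<le> B"
        by (force dest!: compact_imp_bounded simp: bounded_iff)
      show ?thesis
      proof (rule Bochner_Integration.integrable_bound)
        show "integrable lborel (\<lambda>z. B *\<^sub>R (indicat_real (cball 0 R) z *\<^sub>R D z))"
          using intD by (intro integrable_scaleR_right)
        show "AE z in lborel. norm (\<phi> z *\<^sub>R D z) \<le> norm (B *\<^sub>R (indicat_real (cball 0 R) z *\<^sub>R D z))"
        proof (intro AE_I2)
          fix z show "norm (\<phi> z *\<^sub>R D z) \<le> norm (B *\<^sub>R (indicat_real (cball 0 R) z *\<^sub>R D z))"
            using B[of z] \<phi>0[of z] by (cases "cmod z \<le> R") (auto intro!: mult_right_mono)
        qed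
      qed simp
    qed
    have "integral\<^sup>L lborel ?\<eta> = 0"
    proof (rule integral_directional_derivative_eq_0[where \<psi> = "\<lambda>z. \<phi> z *\<^sub>R F z" and R = R])
      show "(v, if v = 1 then \<i> else 1) = (1, \<i>) \<or> (v, if v = 1 then \<i> else 1) = (\<i>, 1)"
        using v by auto
      show "continuous_on UNIV (\<lambda>z. \<phi> z *\<^sub>R F z)" by (intro continuous_intros c\<phi> cont)
      show "integrable lborel ?\<eta>" using i1 i2 by simp
      show "\<phi> z *\<^sub>R F z = 0 \<and> ?\<eta> z = 0" if "R \<le> cmod z" for z
        using that \<phi>0 \<phi>'0 by simp
      fix z :: complex assume z: "cmod z \<noteq> 1"
      have "(\<phi> has_derivative frechet_derivative \<phi> (at z)) (at z)"
        using dif frechet_derivative_works by blast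
      then have "(\<phi> has_derivative frechet_derivative \<phi> (at z)) (at (z + of_real 0 * v))" by simp
      then have d1: "((\<lambda>t. \<phi> (z + of_real t * v)) has_derivative (\<lambda>t. frechet_derivative \<phi> (at z) (of_real t * v))) (at 0)"
        by (rule has_derivative_compose[rotated]) (auto intro!: derivative_eq_intros)
      have d2: "frechet_derivative \<phi> (at z) (of_real t * v) = t * frechet_derivative \<phi> (at z) v" for t
        using linear_frechet_derivative[OF dif[of z]] by (simp add: linear_cmul scaleR_conv_of_real[symmetric])
      have "((\<lambda>t. \<phi> (z + of_real t * v)) has_field_derivative frechet_derivative \<phi> (at z) v) (at 0)"
        unfolding has_field_derivative_def by (rule has_derivative_eq_rhs[OF d1]) (simp add: d2 fun_eq_iff)
      from has_vector_derivative_scaleR[OF this der[OF z]]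
      show "((\<lambda>t. \<phi> (z + of_real t * v) *\<^sub>R F (z + of_real t * v)) has_vector_derivative ?\<eta> z) (at 0)"
        by (simp add: add.commute)
    qed
    then have "(LINT z|lborel. frechet_derivative \<phi> (at z) v *\<^sub>R F z) = - (LINT z|lborel. \<phi> z *\<^sub>R D z)"
      using i1 i2 by (simp add: eq_neg_iff_add_eq_0)
    then show ?thesis by (simp add: integral_completion)
  qed
  show ?thesis
    unfolding weak_directional_derivative_def using locF locD parts by blast
qed

lemma homeomorphism_UNIV_of_inj_proper:
  fixes F :: "'a::euclidean_space \<Rightarrow> 'a"
  assumes cont: "continuous_on UNIV F" and inj: "inj F"
    and proper: "\<And>B. \<exists>R. \<forall>z. R < norm z \<longrightarrow> B < norm (F z)"
  shows "\<exists>G. homeomorphism UNIV UNIV F G"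
proof -
  have op: "open (range F)" by (rule invariance_of_domain[OF cont open_UNIV inj])
  have "closed (range F)"
  proof (rule closure_subset_eq[THEN iffD1], rule subsetI)
    fix y assume y: "y \<in> closure (range F)"
    obtain R where R: "\<And>z. R < norm z \<Longrightarrow> norm y + 1 < norm (F z)" using proper by blast
    have "compact (F ` cball 0 R)"
      by (intro compact_continuous_image continuous_on_subset[OF cont]) auto
    then have cl: "closed (F ` cball 0 R)" by (rule compact_imp_closed)
    have "F z \<in> F ` cball 0 R \<union> - ball 0 (norm y + 1)" for z
      using R[of z] by (cases "norm z \<le> R") auto
    then have "range F \<subseteq> F ` cball 0 R \<union> - ball 0 (norm y + 1)" by blast
    moreover have "closed (F ` cball 0 R \<union> - ball 0 (norm y + 1))"
      using cl by (intro closed_Un closed_Compl) auto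
    ultimately have "closure (range F) \<subseteq> F ` cball 0 R \<union> - ball 0 (norm y + 1)"
      by (rule closure_minimal)
    then show "y \<in> range F" using y by auto
  qed
  with op have "range F = UNIV" using clopen[of "range F"] by auto
  then show ?thesis
    using invariance_of_domain_homeomorphism[OF open_UNIV cont _ inj] by auto
qed

text \<open>
  A criterion for quasiconformality in terms of pointwise derivatives: the unit circle is removable
  when the map is continuous and its derivative blows up at most like an integrable power of the
  distance.
\<close>
lemma quasiconformal_off_circle:
  fixes F \<mu> \<nu> :: "complex \<Rightarrow> complex"
  assumes k: "0 \<le> k" "k < 1" and cont: "continuous_on UNIV F"
    and homeo: "\<exists>G. homeomorphism UNIV UNIV F G"
    and der: "\<And>z. cmod z \<noteq> 1 \<Longrightarrow> (F has_derivative (\<lambda>d. \<mu> z * d + \<nu> z * cnj d)) (at z)"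
    and beltrami: "\<And>z. cmod z \<noteq> 1 \<Longrightarrow> cmod (\<nu> z) \<le> k * cmod (\<mu> z)"
    and a: "0 < a" "a < 1"
    and bound: "\<And>R. \<exists>C. \<forall>z. cmod z \<le> R \<longrightarrow> cmod z \<noteq> 1 \<longrightarrow> cmod (\<mu> z) \<le> C * \<bar>cmod z - 1\<bar> powr (- a)"
  shows "quasiconformal k F"
proof -
  define D where "D v z = (if cmod z = 1 then 0 else \<mu> z * v + \<nu> z * cnj v)" for v z
  have weak: "weak_directional_derivative v F (D v)" if v: "v = 1 \<or> v = \<i>" for v
  proof (rule weak_directional_derivative_off_circle[OF v cont _ a])
    show "((\<lambda>t. F (z + of_real t * v)) has_vector_derivative D v z) (at 0)" if z: "cmod z \<noteq> 1" for z
    proof -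
      have "((\<lambda>t. z + of_real t * v) has_derivative (\<lambda>t. of_real t * v)) (at 0)"
        by (auto intro!: derivative_eq_intros)
      moreover have "(F has_derivative (\<lambda>d. \<mu> z * d + \<nu> z * cnj d)) (at (z + of_real 0 * v))"
        using der[OF z] by simp
      ultimately have *: "((\<lambda>t. F (z + of_real t * v)) has_derivative
          (\<lambda>t. \<mu> z * (of_real t * v) + \<nu> z * cnj (of_real t * v))) (at 0)"
        by (rule has_derivative_compose)
      show ?thesis
        unfolding has_vector_derivative_def using z
        by (intro has_derivative_eq_rhs[OF *]) (simp add: D_def scaleR_conv_of_real algebra_simps fun_eq_iff)
    qed
    fix R
    obtain C where C: "\<And>z. cmod z \<le> R \<Longrightarrow> cmod z \<noteq> 1 \<Longrightarrow> cmod (\<mu> z) \<le> C * \<bar>cmod z - 1\<bar> powr (- a)"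
      using bound by blast
    have "cmod (D v z) \<le> 2 * C * \<bar>cmod z - 1\<bar> powr (- a)" if z: "cmod z \<le> R" for z
    proof (cases "cmod z = 1")
      case False
      have v1: "cmod v = 1" using v by auto
      have "cmod (D v z) \<le> cmod (\<mu> z) + cmod (\<nu> z)"
        using norm_triangle_ineq[of "\<mu> z * v" "\<nu> z * cnj v"] False v1 by (simp add: D_def norm_mult)
      also have "\<dots> \<le> cmod (\<mu> z) + 1 * cmod (\<mu> z)"
        using beltrami[OF False] mult_right_mono[of k 1 "cmod (\<mu> z)"] k by simp
      finally show ?thesis using C[OF z False] by simp
    qed (simp add: D_def)
    then show "\<exists>M. \<forall>z. cmod z \<le> R \<longrightarrow> cmod (D v z) \<le> M * \<bar>cmod z - 1\<bar> powr (- a)"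
      by blast
  qed
  have "cmod ((D 1 z + \<i> * D \<i> z) / 2) \<le> k * cmod ((D 1 z - \<i> * D \<i> z) / 2)" for z
  proof (cases "cmod z = 1")
    case False
    have "D 1 z + \<i> * D \<i> z = 2 * \<nu> z" "D 1 z - \<i> * D \<i> z = 2 * \<mu> z"
      using False by (simp_all add: D_def algebra_simps)
    then show ?thesis using beltrami[OF False] by simp
  qed (simp add: D_def)
  then show ?thesis
    unfolding quasiconformal_def using k homeo weak by blast
qed

section \<open>Reflection in a Lipschitz graph\<close>

lemma lipschitz_primitive_ge_right:
  fixes \<rho> R :: "real \<Rightarrow> real"
  assumes lip: "\<And>x y. \<bar>\<rho> x - \<rho> y\<bar> \<le> T * \<bar>x - y\<bar>"
    and R: "\<And>x. (R has_real_derivative \<rho> x) (at x)" and "a \<le> b"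
  shows "\<rho> b * (b - a) - T * (b - a)\<^sup>2 / 2 \<le> R b - R a"
proof -
  have "(\<lambda>x. R b - R x - \<rho> b * (b - x) + T * (b - x)\<^sup>2 / 2) b
      \<le> (\<lambda>x. R b - R x - \<rho> b * (b - x) + T * (b - x)\<^sup>2 / 2) a"
  proof (rule DERIV_nonpos_imp_nonincreasing[OF \<open>a \<le> b\<close>])
    fix x assume x: "a \<le> x" "x \<le> b"
    have "((\<lambda>x. R b - R x - \<rho> b * (b - x) + T * (b - x)\<^sup>2 / 2) has_real_derivative
       (\<rho> b - \<rho> x - T * (b - x))) (at x)"
      by (auto intro!: derivative_eq_intros R simp: field_simps)
    moreover have "\<rho> b - \<rho> x - T * (b - x) \<le> 0" using lip[of b x] x by simp
    ultimately show "\<exists>y. ((\<lambda>x. R b - R x - \<rho> b * (b - x) + T * (b - x)\<^sup>2 / 2) has_real_derivative y) (at x) \<and> y \<le> 0"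
      by blast
  qed
  then show ?thesis by simp
qed

lemma lipschitz_primitive_ge_left:
  fixes \<rho> R :: "real \<Rightarrow> real"
  assumes lip: "\<And>x y. \<bar>\<rho> x - \<rho> y\<bar> \<le> T * \<bar>x - y\<bar>"
    and R: "\<And>x. (R has_real_derivative \<rho> x) (at x)" and "a \<le> b"
  shows "\<rho> a * (b - a) - T * (b - a)\<^sup>2 / 2 \<le> R b - R a"
proof -
  have lip': "\<bar>\<rho> (- x) - \<rho> (- y)\<bar> \<le> T * \<bar>x - y\<bar>" for x y
    using lip[of "- x" "- y"] by (simp add: abs_minus_commute)
  have R': "((\<lambda>x. - R (- x)) has_real_derivative \<rho> (- x)) (at x)" for x
  proof -
    have "((\<lambda>x. R (- x)) has_real_derivative \<rho> (- x) * - 1) (at x)"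
      by (rule DERIV_chain2[OF R]) (auto intro!: derivative_eq_intros)
    from DERIV_minus[OF this] show ?thesis by simp
  qed
  have "\<rho> (- (- a)) * (- a - - b) - T * (- a - - b)\<^sup>2 / 2 \<le> - R (- (- a)) - (- R (- (- b)))"
    by (rule lipschitz_primitive_ge_right[OF lip' R']) (use \<open>a \<le> b\<close> in simp)
  then show ?thesis by simp
qed

text \<open>
  The primitive is compared with that of the tent function
  \<open>max (\<rho> (v + d) - T * (v + d - x)) (\<rho> (v - d) - T * (x - v + d))\<close>, which lies below \<open>\<rho>\<close>.
\<close>
lemma lipschitz_mean_ge:
  fixes \<rho> R :: "real \<Rightarrow> real" and v d :: real
  assumes lip: "\<And>x y. \<bar>\<rho> x - \<rho> y\<bar> \<le> T * \<bar>x - y\<bar>"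
    and R: "\<And>x. (R has_real_derivative \<rho> x) (at x)" and "0 < d" "0 < T"
  defines "t \<equiv> (\<rho> (v + d) - \<rho> (v - d)) / (2 * d)"
  shows "\<bar>t\<bar> \<le> T"
    and "(\<rho> (v + d) + \<rho> (v - d)) / 2 - (R (v + d) - R (v - d)) / (2 * d) \<le> d * (T\<^sup>2 - t\<^sup>2) / (2 * T)"
proof -
  have "\<bar>\<rho> (v + d) - \<rho> (v - d)\<bar> \<le> T * (2 * d)" using lip[of "v + d" "v - d"] \<open>0 < d\<close> by simp
  then show tT: "\<bar>t\<bar> \<le> T" using \<open>0 < d\<close> by (simp add: t_def field_simps)
  define s where "s = t / T"
  have s: "\<bar>s\<bar> \<le> 1" "t = s * T" using tT \<open>0 < T\<close> by (auto simp: s_def)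
  \<comment> \<open>The two branches of the tent meet at \<open>v + d - L\<close>.\<close>
  define L where "L = d * (1 + s)"
  have L: "0 \<le> L" "L \<le> 2 * d" using s \<open>0 < d\<close> by (auto simp: L_def mult_left_le abs_le_iff)
  have AB: "\<rho> (v + d) - \<rho> (v - d) = 2 * d * s * T" using \<open>0 < d\<close> s(2) by (simp add: t_def field_simps)
  have 1: "\<rho> (v + d) * L - T * L\<^sup>2 / 2 \<le> R (v + d) - R (v + d - L)"
    using lipschitz_primitive_ge_right[OF lip R, of "v + d - L" "v + d"] L by simp
  have 2: "\<rho> (v - d) * (2 * d - L) - T * (2 * d - L)\<^sup>2 / 2 \<le> R (v + d - L) - R (v - d)"
    using lipschitz_primitive_ge_left[OF lip R, of "v - d" "v + d - L"] L
    by (simp add: algebra_simps)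
  have A: "\<rho> (v + d) = \<rho> (v - d) + 2 * d * s * T" using AB by simp
  have "d * (\<rho> (v + d) + \<rho> (v - d)) - T * d\<^sup>2 * (1 - s\<^sup>2)
      = \<rho> (v + d) * L - T * L\<^sup>2 / 2 + (\<rho> (v - d) * (2 * d - L) - T * (2 * d - L)\<^sup>2 / 2)"
    unfolding L_def A by (simp add: power2_eq_square field_simps)
  then have "d * (\<rho> (v + d) + \<rho> (v - d)) - T * d\<^sup>2 * (1 - s\<^sup>2) \<le> R (v + d) - R (v - d)"
    using 1 2 by linarith
  moreover have "T * (1 - s\<^sup>2) = (T\<^sup>2 - t\<^sup>2) / T" using \<open>0 < T\<close> s(2)
    by (simp add: power2_eq_square field_simps)
  ultimately have "d * (\<rho> (v + d) + \<rho> (v - d)) - d\<^sup>2 * ((T\<^sup>2 - t\<^sup>2) / T) \<le> R (v + d) - R (v - d)"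
    by (metis mult.assoc mult.commute)
  then have "(d * (\<rho> (v + d) + \<rho> (v - d)) - d\<^sup>2 * ((T\<^sup>2 - t\<^sup>2) / T)) / (2 * d) \<le> (R (v + d) - R (v - d)) / (2 * d)"
    using \<open>0 < d\<close> by (intro divide_right_mono) auto
  moreover have "(d * (\<rho> (v + d) + \<rho> (v - d)) - d\<^sup>2 * ((T\<^sup>2 - t\<^sup>2) / T)) / (2 * d)
      = (\<rho> (v + d) + \<rho> (v - d)) / 2 - d * (T\<^sup>2 - t\<^sup>2) / (2 * T)"
    using \<open>0 < d\<close> by (simp add: diff_divide_distrib right_diff_distrib power2_eq_square)
  ultimately show "(\<rho> (v + d) + \<rho> (v - d)) / 2 - (R (v + d) - R (v - d)) / (2 * d) \<le> d * (T\<^sup>2 - t\<^sup>2) / (2 * T)"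
    by linarith
qed

text \<open>
  The trapezoidal rule for a Lipschitz function. The error vanishes when the slope \<open>t\<close> of the
  chord is extremal; this is what makes the reflection below quasiconformal with the sharp
  constant.
\<close>
lemma lipschitz_trapezoid_error:
  fixes \<rho> R :: "real \<Rightarrow> real" and v d :: real
  assumes lip: "\<And>x y. \<bar>\<rho> x - \<rho> y\<bar> \<le> T * \<bar>x - y\<bar>"
    and R: "\<And>x. (R has_real_derivative \<rho> x) (at x)" and d: "0 < d" "0 < T"
  defines "t \<equiv> (\<rho> (v + d) - \<rho> (v - d)) / (2 * d)"
  shows "\<bar>(\<rho> (v + d) + \<rho> (v - d)) / 2 - (R (v + d) - R (v - d)) / (2 * d)\<bar> \<le> d * (T\<^sup>2 - t\<^sup>2) / (2 * T)"
proof -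
  have lip': "\<bar>(- \<rho> x) - (- \<rho> y)\<bar> \<le> T * \<bar>x - y\<bar>" for x y
    using lip[of x y] by (simp add: abs_minus_commute)
  have R': "((\<lambda>x. - R x) has_real_derivative - \<rho> x) (at x)" for x
    by (intro DERIV_minus R)
  have t2: "((- \<rho> (v + d) - - \<rho> (v - d)) / (2 * d))\<^sup>2 = t\<^sup>2"
    unfolding t_def by (simp add: power_divide power2_commute)
  have "(- \<rho> (v + d) + - \<rho> (v - d)) / 2 - (- R (v + d) - - R (v - d)) / (2 * d)
      = - ((\<rho> (v + d) + \<rho> (v - d)) / 2 - (R (v + d) - R (v - d)) / (2 * d))"
    by (simp add: diff_divide_distrib add_divide_distrib)
  then show ?thesis
    using lipschitz_mean_ge(2)[OF lip R d, of v] lipschitz_mean_ge(2)[OF lip' R' d, of v]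
    unfolding t2 t_def[symmetric] by (simp only: abs_le_iff)
qed

text \<open>
  The graph of \<open>\<rho>\<close> is regarded as a curve over the imaginary axis: it consists of the points
  \<open>w\<close> with \<open>Re w = \<rho> (Im w)\<close>. The function \<open>R\<close> is a primitive of \<open>\<rho>\<close>.
\<close>
locale lipschitz_graph =
  fixes \<rho> R :: "real \<Rightarrow> real" and \<beta> :: real
  assumes beta: "0 < \<beta>" "\<beta> < pi / 2"
    and lip: "\<And>x y. \<bar>\<rho> x - \<rho> y\<bar> \<le> tan \<beta> * \<bar>x - y\<bar>"
    and prim: "\<And>x. (R has_real_derivative \<rho> x) (at x)"
begin

text \<open>
  The mean of \<open>\<rho>\<close> over the interval with centre \<open>v\<close> and radius \<open>cos \<beta> * \<bar>e\<bar>\<close>, read as \<open>\<rho> v\<close> for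
  \<open>e = 0\<close>; the formula is even in \<open>e\<close>. Averaging makes the mean continuously differentiable for \<open>e \<noteq> 0\<close>, with partial derivatives
  \<open>avg_v\<close> and \<open>avg_e\<close>, although \<open>\<rho>\<close> is only Lipschitz. The factor \<open>cos \<beta>\<close> keeps the derivative
  in \<open>e\<close> small enough for the Beltrami estimate.
\<close>
definition avg :: "real \<Rightarrow> real \<Rightarrow> real" where
  "avg v e = (if e = 0 then \<rho> v else (R (v + cos \<beta> * e) - R (v - cos \<beta> * e)) / (2 * cos \<beta> * e))"

definition avg_v :: "real \<Rightarrow> real \<Rightarrow> real" where
  "avg_v v e = (\<rho> (v + cos \<beta> * e) - \<rho> (v - cos \<beta> * e)) / (2 * cos \<beta> * e)"

definition avg_e :: "real \<Rightarrow> real \<Rightarrow> real" where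
  "avg_e v e = ((\<rho> (v + cos \<beta> * e) + \<rho> (v - cos \<beta> * e)) / 2 - avg v e) / e"

lemma cos_pos: "0 < cos \<beta>" and tan_pos: "0 < tan \<beta>" and sin_pos: "0 < sin \<beta>"
  using beta by (auto simp: cos_gt_zero tan_gt_zero sin_gt_zero2)

lemma avg_0 [simp]: "avg v 0 = \<rho> v" by (simp add: avg_def)

lemma avg_minus [simp]: "avg v (- e) = avg v e"
  by (simp add: avg_def) (metis (no_types) minus_diff_eq minus_divide_left minus_minus)

lemma avg_abs [simp]: "avg v \<bar>e\<bar> = avg v e"
  by (cases "e \<ge> 0") (auto simp: abs_if)

lemma avg_v_bound: "0 < e \<Longrightarrow> \<bar>avg_v v e\<bar> \<le> tan \<beta>"
  using lipschitz_mean_ge(1)[OF lip prim, of "cos \<beta> * e" v] cos_pos tan_pos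
  by (simp add: avg_v_def mult.assoc)

lemma avg_e_bound:
  assumes "0 < e"
  shows "\<bar>avg_e v e\<bar> \<le> cos \<beta> * ((tan \<beta>)\<^sup>2 - (avg_v v e)\<^sup>2) / (2 * tan \<beta>)"
  using lipschitz_trapezoid_error[OF lip prim, of "cos \<beta> * e" v] cos_pos tan_pos assms
  by (simp add: avg_v_def avg_def avg_e_def mult.assoc abs_divide field_simps)

lemma avg_e_half:
  assumes "0 < e"
  shows "\<bar>avg_e v e\<bar> \<le> 1 / 2"
proof -
  have "cos \<beta> * ((tan \<beta>)\<^sup>2 - (avg_v v e)\<^sup>2) / (2 * tan \<beta>) \<le> cos \<beta> * (tan \<beta>)\<^sup>2 / (2 * tan \<beta>)"
    using cos_pos tan_pos by (intro divide_right_mono mult_left_mono) auto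
  also have "\<dots> = sin \<beta> / 2" using cos_pos tan_pos by (simp add: power2_eq_square tan_def)
  also have "\<dots> \<le> 1 / 2" by simp
  finally show ?thesis using avg_e_bound[OF assms, of v] by simp
qed

text \<open>
  In terms of the partial derivatives \<open>a\<close> and \<open>b\<close> of the mean, this is exactly the condition that the
  reflection has dilatation at most \<open>sin \<beta>\<close>.
\<close>
lemma beltrami_avg:
  assumes "0 < e"
  shows "(avg_v v e)\<^sup>2 + (avg_e v e)\<^sup>2 \<le> (sin \<beta>)\<^sup>2 * (1 + (avg_v v e)\<^sup>2)"
proof -
  define T a b c where "T = tan \<beta>" and "a = avg_v v e" and "b = avg_e v e" and "c = cos \<beta>"
  have T: "0 < T" and c: "0 < c" using tan_pos cos_pos by (auto simp: T_def c_def)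
  have a: "0 \<le> T\<^sup>2 - a\<^sup>2" using avg_v_bound[OF assms, of v] T
    by (simp add: a_def T_def abs_le_square_iff[symmetric])
  have "b\<^sup>2 \<le> (c * (T\<^sup>2 - a\<^sup>2) / (2 * T))\<^sup>2"
    using avg_e_bound[OF assms, of v] unfolding T_def a_def b_def c_def
    by (rule power2_le_iff_abs_le[THEN iffD2, rotated]) (meson abs_ge_zero assms avg_e_bound order_trans)
  also have "\<dots> = c\<^sup>2 * (T\<^sup>2 - a\<^sup>2) * ((T\<^sup>2 - a\<^sup>2) / (4 * T\<^sup>2))"
    by (simp add: power2_eq_square)
  also have "\<dots> \<le> c\<^sup>2 * (T\<^sup>2 - a\<^sup>2) * 1"
  proof (intro mult_left_mono)
    have "T\<^sup>2 - a\<^sup>2 \<le> 4 * T\<^sup>2" using zero_le_power2[of a] zero_le_power2[of T] by linarith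
    then show "(T\<^sup>2 - a\<^sup>2) / (4 * T\<^sup>2) \<le> 1" using T by simp
  qed (use a in auto)
  finally have "b\<^sup>2 \<le> c\<^sup>2 * T\<^sup>2 - c\<^sup>2 * a\<^sup>2" by (simp add: algebra_simps)
  moreover have "c\<^sup>2 * T\<^sup>2 = (sin \<beta>)\<^sup>2" using c by (simp add: c_def T_def tan_def power_divide)
  moreover have "c\<^sup>2 = 1 - (sin \<beta>)\<^sup>2" by (simp add: c_def cos_squared_eq)
  ultimately show ?thesis unfolding a_def[symmetric] b_def[symmetric] by (simp add: algebra_simps)
qed

lemma has_derivative_avg:
  assumes "0 < Re y"
  shows "((\<lambda>y. avg (Im y) (Re y)) has_derivative
           (\<lambda>d. avg_v (Im y) (Re y) * Im d + avg_e (Im y) (Re y) * Re d)) (at y)"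
proof -
  let ?c = "cos \<beta>"
  have "((\<lambda>y. (R (Im y + ?c * Re y) - R (Im y - ?c * Re y)) / (2 * ?c * Re y)) has_derivative
      (\<lambda>d. avg_v (Im y) (Re y) * Im d + avg_e (Im y) (Re y) * Re d)) (at y)"
  proof -
    have p: "((\<lambda>y. R (Im y + ?c * Re y)) has_derivative (\<lambda>d. (Im d + ?c * Re d) * \<rho> (Im y + ?c * Re y))) (at y)"
      by (rule DERIV_compose_FDERIV[OF prim]) (auto intro!: derivative_eq_intros)
    have m: "((\<lambda>y. R (Im y - ?c * Re y)) has_derivative (\<lambda>d. (Im d - ?c * Re d) * \<rho> (Im y - ?c * Re y))) (at y)"
      by (rule DERIV_compose_FDERIV[OF prim]) (auto intro!: derivative_eq_intros)
    have q: "((\<lambda>y. 2 * ?c * Re y) has_derivative (\<lambda>d. 2 * ?c * Re d)) (at y)"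
      by (auto intro!: derivative_eq_intros)
    show ?thesis
      by (rule has_derivative_eq_rhs[OF has_derivative_divide'[OF has_derivative_diff[OF p m] q]])
         (use assms cos_pos in \<open>auto simp: fun_eq_iff avg_v_def avg_e_def avg_def field_simps power2_eq_square\<close>)
  qed
  then show ?thesis
  proof (rule has_derivative_transform_within_open)
    show "open {y. 0 < Re y}" by (rule open_halfspace_Re_gt)
  qed (use assms in \<open>auto simp: avg_def\<close>)
qed

lemma avg_lipschitz_v:
  shows "\<bar>avg v e - avg w e\<bar> \<le> tan \<beta> * \<bar>v - w\<bar>"
proof -
  have pos: "\<bar>avg v e - avg w e\<bar> \<le> tan \<beta> * \<bar>v - w\<bar>" if e: "0 < e" for e
  proof -
    have "((\<lambda>v. avg v e) has_real_derivative avg_v v e) (at v)" for v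
    proof -
      have "((\<lambda>y. avg (Im y) (Re y)) has_derivative
           (\<lambda>d. avg_v v e * Im d + avg_e v e * Re d)) (at (Complex e v))"
        using has_derivative_avg[of "Complex e v"] e by simp
      then have "((\<lambda>v. avg (Im (Complex e v)) (Re (Complex e v))) has_derivative
           (\<lambda>d. avg_v v e * Im (Complex 0 d) + avg_e v e * Re (Complex 0 d))) (at v)"
        by (rule has_derivative_compose[rotated])
           (auto simp: Complex_eq intro!: derivative_eq_intros)
      then show ?thesis by (simp add: has_field_derivative_def)
    qed
    from field_differentiable_bound[of UNIV "\<lambda>v. avg v e" "\<lambda>v. avg_v v e" "tan \<beta>" v w, OF _ this]
    show ?thesis using avg_v_bound[OF e] by simp
  qed
  show ?thesis
  proof (cases "e = 0")
    case True then show ?thesis using lip by simp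
  next
    case False then show ?thesis using pos[of "\<bar>e\<bar>"] by simp
  qed
qed

lemma avg_near: "\<bar>avg v e - \<rho> v\<bar> \<le> tan \<beta> * (cos \<beta> * \<bar>e\<bar>)"
proof -
  have "\<bar>avg v e - \<rho> v\<bar> \<le> tan \<beta> * (cos \<beta> * e)" if e: "0 < e" for e
  proof -
    have "v - cos \<beta> * e < v + cos \<beta> * e" using e cos_pos by simp
    then obtain z where z: "v - cos \<beta> * e < z" "z < v + cos \<beta> * e"
      "R (v + cos \<beta> * e) - R (v - cos \<beta> * e) = (v + cos \<beta> * e - (v - cos \<beta> * e)) * \<rho> z"
      using MVT2[of _ _ R \<rho>] prim by blast
    then have "avg v e = \<rho> z" using e cos_pos by (simp add: avg_def)
    moreover have "\<bar>\<rho> z - \<rho> v\<bar> \<le> tan \<beta> * \<bar>z - v\<bar>" by (rule lip)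
    moreover have "tan \<beta> * \<bar>z - v\<bar> \<le> tan \<beta> * (cos \<beta> * e)"
      using z tan_pos by (intro mult_left_mono) auto
    ultimately show ?thesis by simp
  qed
  from this[of "\<bar>e\<bar>"] show ?thesis by (cases "e = 0") auto
qed

lemma avg_lipschitz_e: "\<bar>avg v e - avg v e'\<bar> \<le> \<bar>e - e'\<bar> / 2"
proof -
  have der: "((\<lambda>e. avg v e) has_real_derivative avg_e v e) (at e)" if "0 < e" for e
  proof -
    have "((\<lambda>y. avg (Im y) (Re y)) has_derivative
         (\<lambda>d. avg_v v e * Im d + avg_e v e * Re d)) (at (Complex e v))"
      using has_derivative_avg[of "Complex e v"] that by simp
    then have "((\<lambda>e. avg (Im (Complex e v)) (Re (Complex e v))) has_derivative
         (\<lambda>d. avg_v v e * Im (of_real d) + avg_e v e * Re (of_real d))) (at e)"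
      by (rule has_derivative_compose[rotated])
         (auto simp: Complex_eq intro!: derivative_eq_intros)
    then show ?thesis by (simp add: has_field_derivative_def)
  qed
  have cont0: "isCont (\<lambda>e. avg v e) 0"
    unfolding isCont_def
  proof (rule LIM_zero_cancel, rule Lim_null_comparison)
    show "\<forall>\<^sub>F e in at 0. norm (avg v e - avg v 0) \<le> tan \<beta> * (cos \<beta> * \<bar>e\<bar>)"
      using avg_near by (auto intro!: always_eventually)
    show "((\<lambda>e. tan \<beta> * (cos \<beta> * \<bar>e\<bar>)) \<longlongrightarrow> 0) (at 0)"
      by (auto intro!: tendsto_eq_intros)
  qed
  have cont: "isCont (\<lambda>e. avg v e) e" if "0 \<le> e" for e
    using cont0 DERIV_isCont[OF der] that by (cases "e = 0") auto
  have pos: "\<bar>avg v e - avg v e'\<bar> \<le> \<bar>e - e'\<bar> / 2" if "0 \<le> e'" "e' < e" for e e'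
  proof -
    have c: "continuous_on {e'..e} (\<lambda>e. avg v e)"
      using cont that by (intro continuous_at_imp_continuous_on) auto
    have "\<And>x. e' < x \<Longrightarrow> x < e \<Longrightarrow> (\<lambda>e. avg v e) differentiable (at x)"
      using der that by (meson order.strict_trans1 real_differentiable_def)
    from MVT[OF \<open>e' < e\<close> c this]
    obtain l z where z: "e' < z" "z < e" "DERIV (\<lambda>e. avg v e) z :> l" and eq: "avg v e - avg v e' = (e - e') * l"
      by blast
    have "0 < z" using z that by simp
    have "l = avg_e v z" using der[OF \<open>0 < z\<close>] z(3) DERIV_unique by blast
    then have "\<bar>l\<bar> \<le> 1 / 2" using avg_e_half[OF \<open>0 < z\<close>] by simp
    then have "\<bar>e - e'\<bar> * \<bar>l\<bar> \<le> \<bar>e - e'\<bar> * (1 / 2)" by (intro mult_left_mono) auto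
    then show ?thesis unfolding eq by (simp add: abs_mult)
  qed
  have "\<bar>avg v \<bar>e\<bar> - avg v \<bar>e'\<bar>\<bar> \<le> \<bar>\<bar>e\<bar> - \<bar>e'\<bar>\<bar> / 2"
    using pos[of "\<bar>e'\<bar>" "\<bar>e\<bar>"] pos[of "\<bar>e\<bar>" "\<bar>e'\<bar>"]
    by (cases "\<bar>e\<bar>" "\<bar>e'\<bar>" rule: linorder_cases) (auto simp: abs_minus_commute)
  then show ?thesis using abs_triangle_ineq3[of e e'] by simp
qed

lemma ex1_height: "\<exists>!e. avg v e - e = u"
proof -
  define M where "M = 2 * \<bar>\<rho> v - u\<bar>"
  have M: "0 \<le> M" "\<bar>\<rho> v - u\<bar> = M / 2" by (auto simp: M_def)
  have c: "continuous_on {-M..M} (\<lambda>e. avg v e - e)"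
  proof (intro continuous_intros lipschitz_on_continuous_on[of "1/2"] lipschitz_onI)
    show "dist (avg v x) (avg v y) \<le> 1 / 2 * dist x y" for x y
      using avg_lipschitz_e[of v x y] by (simp add: dist_real_def)
  qed auto
  have "\<bar>avg v M - \<rho> v\<bar> \<le> M / 2" using avg_lipschitz_e[of v M 0] M(1) by simp
  then have "avg v M - M \<le> u" "u \<le> avg v (- M) - (- M)"
    using M by (auto simp: abs_le_iff abs_if split: if_splits)
  then obtain e where "avg v e - e = u"
    using IVT2'[of "\<lambda>e. avg v e - e" M u "-M"] c M by auto
  then show ?thesis
  proof (rule ex1I)
    show "e' = e" if "avg v e' - e' = u" for e'
      using avg_lipschitz_e[of v e' e] that \<open>avg v e - e = u\<close> by (auto simp: abs_if split: if_splits)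
  qed
qed

text \<open>
  The curves \<open>Re w = avg (Im w) e - e\<close>, for real \<open>e\<close>, foliate the plane, and \<open>e = 0\<close> gives the graph
  itself. The height of \<open>w\<close> is the parameter of the curve through \<open>w\<close>; it is positive to the left
  of the graph.
\<close>
definition height :: "complex \<Rightarrow> real" where
  "height w = (THE e. avg (Im w) e - e = Re w)"

text \<open>
  The reflection moves \<open>w\<close> horizontally from the curve with parameter \<open>e\<close> to the one with parameter
  \<open>-e\<close>.
\<close>
definition reflect :: "complex \<Rightarrow> complex" where
  "reflect w = w + 2 * of_real (height w)"

lemma height: "avg (Im w) (height w) - height w = Re w"
  unfolding height_def by (rule theI'[OF ex1_height])

lemma height_unique: "avg (Im w) e - e = Re w \<Longrightarrow> height w = e"
  using height ex1_height by blast

lemma height_lipschitz: "\<bar>height w - height z\<bar> \<le> 2 * (tan \<beta> + 1) * cmod (w - z)"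
proof -
  have "height w - height z = (avg (Im w) (height w) - avg (Im z) (height w))
     + (avg (Im z) (height w) - avg (Im z) (height z)) - Re (w - z)"
    using height[of w] height[of z] by simp
  moreover have "\<bar>avg (Im w) (height w) - avg (Im z) (height w)\<bar> \<le> tan \<beta> * cmod (w - z)"
    using avg_lipschitz_v[of "Im w" "height w" "Im z"] abs_Im_le_cmod[of "w - z"] tan_pos
    by (auto intro: order_trans mult_left_mono)
  moreover note avg_lipschitz_e[of "Im z" "height w" "height z"] abs_Re_le_cmod[of "w - z"]
  ultimately have "\<bar>height w - height z\<bar> \<le> tan \<beta> * cmod (w - z) + \<bar>height w - height z\<bar> / 2 + cmod (w - z)"
    by linarith
  then show ?thesis by (simp add: algebra_simps)
qed

lemma continuous_on_height: "continuous_on S height"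
proof (rule lipschitz_on_continuous_on[of "2 * (tan \<beta> + 1)"], rule lipschitz_onI)
  show "dist (height x) (height y) \<le> 2 * (tan \<beta> + 1) * dist x y" for x y
    using height_lipschitz[of x y] by (simp add: dist_norm)
qed (use tan_pos in auto)

lemma height_ge:
  assumes "Re w \<le> \<rho> (Im w)"
  shows "2 / 3 * (\<rho> (Im w) - Re w) \<le> height w"
  using avg_lipschitz_e[of "Im w" "height w" 0] height[of w] assms by (auto simp: abs_if split: if_splits)

lemma height_0: "Re w = \<rho> (Im w) \<Longrightarrow> height w = 0"
  by (rule height_unique) simp

lemma Re_reflect: "Re (reflect w) = avg (Im w) (height w) + height w"
  using height[of w] by (simp add: reflect_def)

lemma Im_reflect [simp]: "Im (reflect w) = Im w"
  by (simp add: reflect_def)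

lemma reflect_above:
  assumes "Re w < \<rho> (Im w)"
  shows "\<rho> (Im (reflect w)) < Re (reflect w)"
proof -
  have h: "0 < height w" using height_ge[of w] assms by simp
  then have "\<bar>avg (Im w) (height w) - \<rho> (Im w)\<bar> \<le> height w / 2"
    using avg_lipschitz_e[of "Im w" "height w" 0] by simp
  with h show ?thesis unfolding Re_reflect Im_reflect by linarith
qed

lemma inj_reflect: "inj reflect"
proof (rule injI)
  fix w z assume eq: "reflect w = reflect z"
  then have im: "Im w = Im z" by (metis Im_reflect)
  have "avg (Im w) (height w) + height w = avg (Im w) (height z) + height z"
    using eq im by (metis Re_reflect)
  then have "height w = height z" using avg_lipschitz_e[of "Im w" "height w" "height z"] by (simp add: abs_if split: if_splits)
  with eq show "w = z" by (simp add: reflect_def)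
qed

lemma height_translate:
  assumes "\<And>x. \<rho> (x + Im t) = \<rho> x + Re t"
  shows "height (w + t) = height w"
proof (rule height_unique)
  have "((\<lambda>x. R (x + Im t) - R x - Re t * x) has_real_derivative 0) (at x)" for x
    using assms by (auto intro!: derivative_eq_intros DERIV_chain2[OF prim])
  then have "R (x + Im t) - R x - Re t * x = R (0 + Im t) - R 0 - Re t * 0" for x
    using DERIV_isconst_all by blast
  then have *: "R (x + Im t) = R x + Re t * x + (R (Im t) - R 0)" for x by (smt (verit) add_0 mult_zero_right)
  have "avg (v + Im t) e = avg v e + Re t" for v e
  proof (cases "e = 0")
    case False
    have "R (v + Im t + cos \<beta> * e) - R (v + Im t - cos \<beta> * e)
        = R (v + cos \<beta> * e) - R (v - cos \<beta> * e) + Re t * (2 * cos \<beta> * e)"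
      using *[of "v + cos \<beta> * e"] *[of "v - cos \<beta> * e"] by (simp add: algebra_simps)
    then show ?thesis using False cos_pos by (simp add: avg_def add_divide_distrib)
  qed (use assms in auto)
  then show "avg (Im (w + t)) (height w) - height w = Re (w + t)"
    using height[of w] by simp
qed

text \<open>
  To the left of the graph the reflection is real-differentiable and sense reversing. Writing the
  derivative as \<open>\<mu> * d + \<nu> * cnj d\<close> identifies its two Wirtinger derivatives.
\<close>
lemma reflect_has_derivative:
  assumes "Re w < \<rho> (Im w)"
  obtains \<mu> \<nu> where "(reflect has_derivative (\<lambda>d. \<mu> * d + \<nu> * cnj d)) (at w)"
    "cmod \<mu> \<le> sin \<beta> * cmod \<nu>" "cmod \<nu> \<le> 2 * (1 + tan \<beta>)"
proof -
  define e a b where "e = height w" and "a = avg_v (Im w) e" and "b = avg_e (Im w) e"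
  have e: "0 < e" using height_ge[of w] assms by (simp add: e_def)
  have b: "\<bar>b\<bar> \<le> 1 / 2" using avg_e_half[OF e] by (simp add: b_def)
  \<comment> \<open>The coordinates \<open>(height z, Im z)\<close> invert an explicit differentiable map.\<close>
  define f where "f y = Complex (avg (Im y) (Re y) - Re y) (Im y)" for y
  define g where "g z = Complex (height z) (Im z)" for z
  have fg: "f (g z) = z" for z
    using height[of z] by (simp add: f_def g_def complex_eq_iff)
  have gd: "(g has_derivative (\<lambda>d. Complex ((a * Im d - Re d) / (1 - b)) (Im d))) (at w)"
  proof (rule has_derivative_inverse_basic[where f = f and T = UNIV])
    have "((\<lambda>y. of_real (avg (Im y) (Re y) - Re y) + \<i> * of_real (Im y)) has_derivative
        (\<lambda>d. of_real (a * Im d + b * Re d - Re d) + \<i> * of_real (Im d))) (at (g w))"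
      using has_derivative_avg[of "g w"] e
      by (auto intro!: derivative_eq_intros simp: g_def a_def b_def e_def)
    then show "(f has_derivative (\<lambda>d. Complex (a * Im d + b * Re d - Re d) (Im d))) (at (g w))"
      by (simp add: f_def[abs_def] Complex_eq)
    show "bounded_linear (\<lambda>d. Complex ((a * Im d - Re d) / (1 - b)) (Im d))"
      unfolding linear_conv_bounded_linear[symmetric]
      by (rule linearI) (auto simp: complex_eq_iff diff_divide_distrib add_divide_distrib algebra_simps)
    show "(\<lambda>d. Complex ((a * Im d - Re d) / (1 - b)) (Im d)) \<circ> (\<lambda>d. Complex (a * Im d + b * Re d - Re d) (Im d)) = id"
      using b by (auto simp: fun_eq_iff complex_eq_iff field_simps)
    show "continuous (at w) g"
      unfolding g_def Complex_eq
      using continuous_on_height[of UNIV] by (intro continuous_intros) (auto simp: continuous_on_eq_continuous_at)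
  qed (use fg in auto)
  then have "((\<lambda>z. Re (g z)) has_derivative (\<lambda>d. (a * Im d - Re d) / (1 - b))) (at w)"
    using has_derivative_Re[OF gd] by simp
  then have hd: "(height has_derivative (\<lambda>d. (a * Im d - Re d) / (1 - b))) (at w)"
    by (simp add: g_def)
  define \<mu> \<nu> where "\<mu> = Complex (- b) (- a) / of_real (1 - b)" and "\<nu> = Complex (- 1) a / of_real (1 - b)"
  have "(reflect has_derivative (\<lambda>d. d + 2 * of_real ((a * Im d - Re d) / (1 - b)))) (at w)"
    unfolding reflect_def[abs_def] by (auto intro!: derivative_eq_intros hd)
  moreover have "d + 2 * of_real ((a * Im d - Re d) / (1 - b)) = \<mu> * d + \<nu> * cnj d" for d
  proof -
    define r where "r = 1 / (1 - b)"
    have "b * r = r - 1" using b by (simp add: r_def field_simps)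
    then have br: "b * (r * x) = r * x - x" for x by (metis left_diff_distrib mult.assoc mult_1)
    show ?thesis
      using br[of "Re d"] br[of "Im d"]
      by (simp add: \<mu>_def \<nu>_def divide_inverse r_def[symmetric, unfolded divide_inverse mult_1]
          complex_eq_iff algebra_simps del: of_real_diff flip: of_real_inverse)
  qed
  ultimately have 1: "(reflect has_derivative (\<lambda>d. \<mu> * d + \<nu> * cnj d)) (at w)" by simp
  have "sqrt (b\<^sup>2 + a\<^sup>2) \<le> sqrt ((sin \<beta>)\<^sup>2 * (1 + a\<^sup>2))"
    using beltrami_avg[OF e, of "Im w"] by (simp add: a_def b_def add.commute)
  also have "\<dots> = sin \<beta> * sqrt (1 + a\<^sup>2)" using sin_pos by (simp add: real_sqrt_mult)
  finally have 2: "cmod \<mu> \<le> sin \<beta> * cmod \<nu>"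
    using b by (simp add: \<mu>_def \<nu>_def norm_divide complex_norm divide_right_mono del: of_real_diff)
  have "cmod (Complex (- 1) a) \<le> 1 + \<bar>a\<bar>" using cmod_le[of "Complex (- 1) a"] by simp
  also have "\<dots> \<le> 1 + tan \<beta>" using avg_v_bound[OF e] by (simp add: a_def)
  finally have "cmod \<nu> \<le> (1 + tan \<beta>) / (1 / 2)"
    unfolding \<nu>_def norm_divide norm_of_real using b tan_pos by (intro frac_le) auto
  then have 3: "cmod \<nu> \<le> 2 * (1 + tan \<beta>)" by simp
  show thesis using that[OF 1 2 3] .
qed

end

section \<open>Extension of half-plane maps with derivative in a sector\<close>

lemma ex_primitive:
  fixes f :: "real \<Rightarrow> real"
  assumes "continuous_on UNIV f"
  shows "\<exists>F. \<forall>x. (F has_real_derivative f x) (at x)"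
  using einterval_antiderivative[of "- \<infinity>" \<infinity> f] assms
  by (auto simp: continuous_on_eq_continuous_at has_real_derivative_iff_has_vector_derivative)

text \<open>
  A map of the closed left half-plane, conformal inside, whose derivative stays in the sector of
  half-angle \<open>\<beta>\<close> about the positive axis, and which differs from the rotation by \<open>- lam\<close> by a bounded
  function of period \<open>2 * pi * \<i>\<close>.
\<close>
locale half_plane_map =
  fixes h h' :: "complex \<Rightarrow> complex" and lam \<beta> M :: real
  assumes beta: "0 < \<beta>" "\<beta> < pi / 2"
    and cos_lam: "0 < cos lam"
    and cont: "continuous_on {\<zeta>. Re \<zeta> \<le> 0} h"
    and deriv: "\<And>\<zeta>. Re \<zeta> < 0 \<Longrightarrow> (h has_field_derivative h' \<zeta>) (at \<zeta>)"
    and Re_pos: "\<And>\<zeta>. Re \<zeta> < 0 \<Longrightarrow> 0 < Re (h' \<zeta>)"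
    and sector: "\<And>\<zeta>. Re \<zeta> < 0 \<Longrightarrow> \<bar>Im (h' \<zeta>)\<bar> \<le> tan \<beta> * Re (h' \<zeta>)"
    and period: "\<And>\<zeta>. Re \<zeta> \<le> 0 \<Longrightarrow> h (\<zeta> + 2 * pi * \<i>) = h \<zeta> + 2 * pi * \<i> * cis (- lam)"
    and near: "\<And>\<zeta>. Re \<zeta> \<le> 0 \<Longrightarrow> cmod (h \<zeta> - cis (- lam) * \<zeta>) \<le> M"
begin

text \<open>
  The mean value theorem along a segment that meets the boundary at most at one endpoint.
\<close>
lemma mean_value:
  assumes "Re a \<le> 0" "Re b \<le> 0" "Re a < 0 \<or> Re b < 0" "a \<noteq> b"
  obtains \<zeta> where "Re \<zeta> < 0" "Re (c * (h b - h a)) = Re (c * (b - a) * h' \<zeta>)"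
proof -
  define p where "p t = a + of_real t * (b - a)" for t :: real
  have Rep: "Re (p t) = (1 - t) * Re a + t * Re b" for t by (simp add: p_def algebra_simps)
  have pneg: "Re (p t) < 0" if "0 < t" "t < 1" for t
  proof -
    have "(1 - t) * Re a \<le> 0" "t * Re b \<le> 0" "(1 - t) * Re a < 0 \<or> t * Re b < 0"
      using assms that by (auto simp: mult_le_0_iff mult_less_0_iff)
    then show ?thesis unfolding Rep by linarith
  qed
  have ple: "Re (p t) \<le> 0" if "0 \<le> t" "t \<le> 1" for t
    using assms that unfolding Rep by (intro add_nonpos_nonpos mult_nonneg_nonpos) auto
  have c: "continuous_on {0..1} (\<lambda>t. Re (c * h (p t)))"
    by (intro continuous_intros continuous_on_compose2[OF cont]) (use ple in \<open>auto simp: p_def intro!: continuous_intros\<close>)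
  have d: "((\<lambda>t. Re (c * h (p t))) has_real_derivative Re (c * (b - a) * h' (p t))) (at t)" if "0 < t" "t < 1" for t
  proof -
    have "(p has_vector_derivative (b - a)) (at t)"
      unfolding p_def by (auto intro!: derivative_eq_intros simp: has_vector_derivative_def scaleR_conv_of_real)
    from field_vector_diff_chain_at[OF this deriv[OF pneg[OF that]]]
    have "((\<lambda>t. h (p t)) has_vector_derivative (b - a) * h' (p t)) (at t)" by (simp add: o_def)
    then have "((\<lambda>t. c * h (p t)) has_vector_derivative c * ((b - a) * h' (p t))) (at t)"
      by (rule has_vector_derivative_mult_right)
    then have "((\<lambda>t. Re (c * h (p t))) has_vector_derivative Re (c * ((b - a) * h' (p t)))) (at t)"
      by (rule bounded_linear.has_vector_derivative[OF bounded_linear_Re])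
    then show ?thesis
      by (simp add: has_real_derivative_iff_has_vector_derivative mult.assoc)
  qed
  have "\<And>t. 0 < t \<Longrightarrow> t < 1 \<Longrightarrow> (\<lambda>t. Re (c * h (p t))) differentiable (at t)"
    using d real_differentiable_def by blast
  from MVT[OF zero_less_one c this] obtain l t where t: "0 < t" "t < 1"
      "DERIV (\<lambda>t. Re (c * h (p t))) t :> l" "Re (c * h (p 1)) - Re (c * h (p 0)) = (1 - 0) * l"
    by blast
  have "l = Re (c * (b - a) * h' (p t))" using DERIV_unique[OF t(3) d[OF t(1,2)]] .
  with t(4) have "Re (c * (h b - h a)) = Re (c * (b - a) * h' (p t))"
    by (simp add: p_def algebra_simps)
  with pneg[OF t(1,2)] show thesis by (rule that)
qed

lemma difference_quotient_pos:
  assumes "Re a \<le> 0" "Re b \<le> 0" "Re a < 0 \<or> Re b < 0" "a \<noteq> b"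
    and c: "\<And>\<zeta>. Re \<zeta> < 0 \<Longrightarrow> 0 < Re (c * h' \<zeta>)"
  shows "0 < Re (c * ((h b - h a) / (b - a)))"
proof -
  obtain \<zeta> where "Re \<zeta> < 0" "Re (c / (b - a) * (h b - h a)) = Re (c / (b - a) * (b - a) * h' \<zeta>)"
    using mean_value[OF assms(1-4)] .
  then show ?thesis using c[of \<zeta>] \<open>a \<noteq> b\<close> by simp
qed

text \<open>
  There is no derivative on the boundary, so the segment between two boundary points is replaced
  by two legs of a flat triangle inside the half-plane. Since the sector is narrower than the
  half-plane, both legs still raise the imaginary part if the triangle is flat enough.
\<close>
lemma boundary_strict_mono: "strict_mono (\<lambda>t. Im (h (\<i> * of_real t)))"
proof (rule strict_monoI)
  fix s t :: real assume st: "s < t"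
  define \<eta> where "\<eta> = 1 / (2 * (tan \<beta> + 1))"
  have T: "0 < tan \<beta>" using beta by (simp add: tan_gt_zero)
  have \<eta>: "0 < \<eta>" "\<eta> * tan \<beta> < 1" using T by (auto simp: \<eta>_def field_simps)
  define r where "r = (t - s) / 2"
  have r: "0 < r" using st by (simp add: r_def)
  define m where "m = Complex (- \<eta> * r) (s + r)"
  have step: "0 < r * Re (h' \<zeta>) + x * Im (h' \<zeta>)" if "Re \<zeta> < 0" "\<bar>x\<bar> = \<eta> * r" for \<zeta> x
  proof -
    have "\<bar>x * Im (h' \<zeta>)\<bar> \<le> (\<eta> * r) * (tan \<beta> * Re (h' \<zeta>))"
      unfolding abs_mult that(2) using sector[OF that(1)] \<eta> r by (intro mult_left_mono) auto
    also have "\<dots> = (\<eta> * tan \<beta>) * (r * Re (h' \<zeta>))" by simp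
    also have "\<dots> < 1 * (r * Re (h' \<zeta>))"
      using \<eta> r Re_pos[OF that(1)] by (intro mult_strict_right_mono) auto
    finally show ?thesis by (simp add: abs_less_iff)
  qed
  have "Im (h (\<i> * of_real s)) < Im (h m)"
  proof -
    obtain \<zeta> where "Re \<zeta> < 0" "Re (- \<i> * (h m - h (\<i> * of_real s))) = Re (- \<i> * (m - \<i> * of_real s) * h' \<zeta>)"
      using mean_value[of "\<i> * of_real s" m "- \<i>"] \<eta> r by (auto simp: m_def complex_eq_iff)
    moreover have "m - \<i> * of_real s = Complex (- \<eta> * r) r" by (simp add: m_def complex_eq_iff)
    moreover have "\<bar>- \<eta> * r\<bar> = \<eta> * r" using \<eta> r by (simp add: abs_mult)
    ultimately show ?thesis using step[of \<zeta> "- \<eta> * r"] by simp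
  qed
  also have "Im (h m) < Im (h (\<i> * of_real t))"
  proof -
    obtain \<zeta> where "Re \<zeta> < 0" "Re (- \<i> * (h (\<i> * of_real t) - h m)) = Re (- \<i> * (\<i> * of_real t - m) * h' \<zeta>)"
      using mean_value[of m "\<i> * of_real t" "- \<i>"] \<eta> r by (auto simp: m_def complex_eq_iff)
    moreover have "\<i> * of_real t - m = Complex (\<eta> * r) r" by (simp add: m_def complex_eq_iff r_def field_simps)
    moreover have "\<bar>\<eta> * r\<bar> = \<eta> * r" using \<eta> r by (simp add: abs_mult)
    ultimately show ?thesis using step[of \<zeta> "\<eta> * r"] by simp
  qed
  finally show "Im (h (\<i> * of_real s)) < Im (h (\<i> * of_real t))" .
qed

lemma continuous_boundary: "continuous_on UNIV (\<lambda>t. h (\<i> * of_real t))"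
  by (intro continuous_on_compose2[OF cont] continuous_intros) auto

text \<open>
  The sector condition passes to the boundary by translating the segment to the left.
\<close>
lemma boundary_lipschitz:
  "\<bar>Re (h (\<i> * of_real t)) - Re (h (\<i> * of_real s))\<bar> \<le> tan \<beta> * \<bar>Im (h (\<i> * of_real t)) - Im (h (\<i> * of_real s))\<bar>"
proof -
  have T: "0 < tan \<beta>" using beta by (simp add: tan_gt_zero)
  have main: "\<sigma> * (Re (h (\<i> * of_real t)) - Re (h (\<i> * of_real s)))
      \<le> tan \<beta> * (Im (h (\<i> * of_real t)) - Im (h (\<i> * of_real s)))"
    if st: "s < t" and \<sigma>: "\<bar>\<sigma>\<bar> = 1" for s t \<sigma> :: real
  proof -
    define D where "D e = h (\<i> * of_real t - of_real e) - h (\<i> * of_real s - of_real e)" for e :: real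
    have pos: "0 \<le> Re (Complex (- \<sigma>) (- tan \<beta>) * D e)" if e: "0 < e" for e
    proof -
      obtain \<zeta> where \<zeta>: "Re \<zeta> < 0" "Re (Complex (- \<sigma>) (- tan \<beta>) * D e) =
          Re (Complex (- \<sigma>) (- tan \<beta>) * (\<i> * of_real t - of_real e - (\<i> * of_real s - of_real e)) * h' \<zeta>)"
        unfolding D_def using mean_value[of "\<i> * of_real s - of_real e" "\<i> * of_real t - of_real e" "Complex (- \<sigma>) (- tan \<beta>)"] e st
        by (auto simp: complex_eq_iff)
      have "Re (Complex (- \<sigma>) (- tan \<beta>) * D e) = (t - s) * (tan \<beta> * Re (h' \<zeta>) + \<sigma> * Im (h' \<zeta>))"
        unfolding \<zeta>(2) by (simp add: algebra_simps)
      also have "\<dots> \<ge> 0"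
      proof (rule mult_nonneg_nonneg)
        have "\<bar>\<sigma> * Im (h' \<zeta>)\<bar> \<le> tan \<beta> * Re (h' \<zeta>)" using sector[OF \<zeta>(1)] \<sigma> by (simp add: abs_mult)
        then show "0 \<le> tan \<beta> * Re (h' \<zeta>) + \<sigma> * Im (h' \<zeta>)" by (simp add: abs_le_iff)
      qed (use st in simp)
      finally show ?thesis .
    qed
    have lim: "((\<lambda>e. h (\<i> * of_real x - of_real e)) \<longlongrightarrow> h (\<i> * of_real x)) (at_right 0)" for x
    proof -
      have "continuous_on {0..} (\<lambda>e. h (\<i> * of_real x - of_real e))"
        by (intro continuous_on_compose2[OF cont] continuous_intros) auto
      then have "((\<lambda>e. h (\<i> * of_real x - of_real e)) \<longlongrightarrow> h (\<i> * of_real x - of_real 0)) (at 0 within {0..})"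
        unfolding continuous_on_def by (rule bspec) simp
      moreover have "{0<..} \<subseteq> {0::real..}" by auto
      ultimately have "((\<lambda>e. h (\<i> * of_real x - of_real e)) \<longlongrightarrow> h (\<i> * of_real x - of_real 0)) (at_right 0)"
        by (rule tendsto_within_subset)
      then show ?thesis by simp
    qed
    have "((\<lambda>e. Re (Complex (- \<sigma>) (- tan \<beta>) * D e)) \<longlongrightarrow>
        Re (Complex (- \<sigma>) (- tan \<beta>) * (h (\<i> * of_real t) - h (\<i> * of_real s)))) (at_right 0)"
      unfolding D_def by (intro tendsto_intros lim)
    moreover have "\<forall>\<^sub>F e in at_right 0. 0 \<le> Re (Complex (- \<sigma>) (- tan \<beta>) * D e)"
      by (rule eventually_at_rightI[of 0 1], rule pos) simp_all
    ultimately have "0 \<le> Re (Complex (- \<sigma>) (- tan \<beta>) * (h (\<i> * of_real t) - h (\<i> * of_real s)))"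
      by (rule tendsto_lowerbound) simp
    then show ?thesis by (simp add: algebra_simps)
  qed
  have sym: "\<bar>Re (h (\<i> * of_real t)) - Re (h (\<i> * of_real s))\<bar> \<le> tan \<beta> * \<bar>Im (h (\<i> * of_real t)) - Im (h (\<i> * of_real s))\<bar>"
    if "s < t" for s t
  proof -
    have "0 < Im (h (\<i> * of_real t)) - Im (h (\<i> * of_real s))"
      using strict_monoD[OF boundary_strict_mono that] by simp
    then show ?thesis using main[OF that, of 1] main[OF that, of "-1"] by (simp add: abs_le_iff)
  qed
  show ?thesis
    using sym[of s t] sym[of t s] by (cases s t rule: linorder_cases) (auto simp: abs_minus_commute)
qed

lemma near': "\<bar>Re (h \<zeta>) - (cos lam * Re \<zeta> + sin lam * Im \<zeta>)\<bar> \<le> M"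
    "\<bar>Im (h \<zeta>) - (cos lam * Im \<zeta> - sin lam * Re \<zeta>)\<bar> \<le> M" if "Re \<zeta> \<le> 0"
  using abs_Re_le_cmod[of "h \<zeta> - cis (- lam) * \<zeta>"] abs_Im_le_cmod[of "h \<zeta> - cis (- lam) * \<zeta>"] near[OF that]
  by (auto simp: algebra_simps)

lemma M_nonneg: "0 \<le> M"
  using order_trans[OF norm_ge_zero near[of 0]] by simp

lemma boundary_surj: "\<exists>t. Im (h (\<i> * of_real t)) = x"
proof -
  define r where "r = (\<bar>x\<bar> + M) / cos lam"
  have r: "cos lam * r = \<bar>x\<bar> + M" "0 \<le> r" using cos_lam M_nonneg by (auto simp: r_def)
  have "Im (h (\<i> * of_real (- r))) \<le> x" "x \<le> Im (h (\<i> * of_real r))"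
    using near'(2)[of "\<i> * of_real (- r)"] near'(2)[of "\<i> * of_real r"] r by (auto simp: abs_le_iff)
  then have "\<exists>t\<ge>-r. t \<le> r \<and> Im (h (\<i> * of_real t)) = x"
    using r by (intro IVT') (auto intro!: continuous_intros continuous_on_subset[OF continuous_boundary])
  then show ?thesis by blast
qed

text \<open>
  The boundary function: the image of the imaginary axis under \<open>h\<close> consists of the points \<open>w\<close> with
  \<open>Re w = bd (Im w)\<close>. The parameter chosen in the definition is unique by strict monotonicity.
\<close>
definition bd :: "real \<Rightarrow> real" where
  "bd x = Re (h (\<i> * of_real (SOME t. Im (h (\<i> * of_real t)) = x)))"

lemma bd_Im: "bd (Im (h (\<i> * of_real t))) = Re (h (\<i> * of_real t))"
proof -
  define s where "s = (SOME s. Im (h (\<i> * of_real s)) = Im (h (\<i> * of_real t)))"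
  have "Im (h (\<i> * of_real s)) = Im (h (\<i> * of_real t))"
    unfolding s_def by (rule someI) (rule refl)
  then have "s = t" using strict_mono_eq[OF boundary_strict_mono] by simp
  then show ?thesis by (simp add: bd_def s_def)
qed

lemma bd_lipschitz: "\<bar>bd x - bd y\<bar> \<le> tan \<beta> * \<bar>x - y\<bar>"
  using boundary_surj[of x] boundary_surj[of y] boundary_lipschitz bd_Im by metis

lemma bd_near: "\<bar>cos lam * bd x - sin lam * x\<bar> \<le> 2 * M"
proof -
  obtain t where t: "Im (h (\<i> * of_real t)) = x" using boundary_surj by blast
  have "bd x = Re (h (\<i> * of_real t))" using bd_Im[of t] t by simp
  then have "\<bar>bd x - sin lam * t\<bar> \<le> M" "\<bar>x - cos lam * t\<bar> \<le> M"
    using near'[of "\<i> * of_real t"] t by auto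
  then have "\<bar>cos lam\<bar> * \<bar>bd x - sin lam * t\<bar> \<le> 1 * M" "\<bar>sin lam\<bar> * \<bar>x - cos lam * t\<bar> \<le> 1 * M"
    using M_nonneg by - (intro mult_mono; simp)+
  moreover have "cos lam * bd x - sin lam * x = cos lam * (bd x - sin lam * t) - sin lam * (x - cos lam * t)"
    by (simp add: algebra_simps)
  moreover have "\<bar>cos lam * (bd x - sin lam * t) - sin lam * (x - cos lam * t)\<bar>
    \<le> \<bar>cos lam\<bar> * \<bar>bd x - sin lam * t\<bar> + \<bar>sin lam\<bar> * \<bar>x - cos lam * t\<bar>"
    by (metis abs_mult abs_triangle_ineq4)
  ultimately show ?thesis by linarith
qed

lemma bd_period: "bd (x + 2 * pi * cos lam) = bd x + 2 * pi * sin lam"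
proof -
  obtain t where t: "Im (h (\<i> * of_real t)) = x" using boundary_surj by blast
  have "h (\<i> * of_real (t + 2 * pi)) = h (\<i> * of_real t) + 2 * pi * \<i> * cis (- lam)"
    using period[of "\<i> * of_real t"] by (simp add: algebra_simps)
  then have "Im (h (\<i> * of_real (t + 2 * pi))) = x + 2 * pi * cos lam"
    "Re (h (\<i> * of_real (t + 2 * pi))) = Re (h (\<i> * of_real t)) + 2 * pi * sin lam"
    using t by simp_all
  then show ?thesis using bd_Im[of "t + 2 * pi"] bd_Im[of t] t by simp
qed

lemma below_bd:
  assumes "Re \<zeta> < 0"
  shows "Re (h \<zeta>) < bd (Im (h \<zeta>))"
proof -
  obtain t where t: "Im (h (\<i> * of_real t)) = Im (h \<zeta>)" using boundary_surj by blast
  define d where "d = \<i> * of_real t - \<zeta>"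
  define x where "x = Re (h (\<i> * of_real t)) - Re (h \<zeta>)"
  have d: "0 < Re d" using assms by (simp add: d_def)
  have "h (\<i> * of_real t) - h \<zeta> = of_real x" using t by (simp add: x_def complex_eq_iff)
  moreover have "0 < Re (1 * ((h (\<i> * of_real t) - h \<zeta>) / (\<i> * of_real t - \<zeta>)))"
    by (rule difference_quotient_pos) (use assms Re_pos in \<open>auto simp: complex_eq_iff\<close>)
  ultimately have "0 < Re (of_real x / d)" by (simp add: d_def)
  then have "0 < x * Re d / (cmod d)\<^sup>2" by (simp add: Re_divide cmod_power2)
  then have "0 < x" using d by (simp add: zero_less_divide_iff zero_less_mult_iff not_less[symmetric])
  then show ?thesis using bd_Im[of t] t by (simp add: x_def)
qed

lemma inj_on_closed_half_plane: "inj_on h {\<zeta>. Re \<zeta> \<le> 0}"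
proof (rule inj_onI)
  fix a b assume ab: "a \<in> {\<zeta>. Re \<zeta> \<le> 0}" "b \<in> {\<zeta>. Re \<zeta> \<le> 0}" and eq: "h a = h b"
  show "a = b"
  proof (cases "Re a < 0 \<or> Re b < 0")
    case True
    show ?thesis
    proof (rule ccontr)
      assume "a \<noteq> b"
      with True ab have "0 < Re (1 * ((h b - h a) / (b - a)))"
        by (intro difference_quotient_pos) (auto simp: Re_pos)
      with eq show False by simp
    qed
  next
    case False
    with ab have ab': "a = \<i> * of_real (Im a)" "b = \<i> * of_real (Im b)" by (auto simp: complex_eq_iff)
    then have "Im (h (\<i> * of_real (Im a))) = Im (h (\<i> * of_real (Im b)))" using eq by metis
    then have "Im a = Im b" using strict_mono_eq[OF boundary_strict_mono] by simp
    with ab' show ?thesis by metis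
  qed
qed

text \<open>
  The extension to the whole plane: across the imaginary axis, \<open>h\<close> is continued by reflecting
  its values in the graph of \<open>bd\<close>. The last property makes the extension tend to infinity
  on the right.
\<close>
lemma extension:
  obtains H where "\<And>\<zeta>. Re \<zeta> \<le> 0 \<Longrightarrow> H \<zeta> = h \<zeta>"
    and "continuous_on UNIV H" and "inj H"
    and "\<And>\<zeta>. H (\<zeta> + 2 * pi * \<i>) = H \<zeta> + 2 * pi * \<i> * cis (- lam)"
    and "\<And>\<zeta>. 0 < Re \<zeta> \<Longrightarrow> \<exists>\<mu> \<nu>. (H has_derivative (\<lambda>d. \<mu> * d + \<nu> * cnj d)) (at \<zeta>)
        \<and> cmod \<nu> \<le> sin \<beta> * cmod \<mu> \<and> cmod \<mu> \<le> 2 * (1 + tan \<beta>) * cmod (h' (- cnj \<zeta>))"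
    and "\<And>\<zeta>. 0 < Re \<zeta> \<Longrightarrow> Re \<zeta> / 3 - 5 * M \<le> Re (cis lam * H \<zeta>)"
proof -
  have "continuous_on UNIV bd"
  proof (rule lipschitz_on_continuous_on[of "tan \<beta>"], rule lipschitz_onI)
    show "dist (bd x) (bd y) \<le> tan \<beta> * dist x y" for x y
      using bd_lipschitz by (simp add: dist_real_def)
  qed (use beta in \<open>simp add: tan_gt_zero less_imp_le\<close>)
  then obtain R where R: "\<And>x. (R has_real_derivative bd x) (at x)"
    using ex_primitive by blast
  interpret lipschitz_graph bd R \<beta>
    by unfold_locales (use beta bd_lipschitz R in auto)
  define H where "H \<zeta> = (if Re \<zeta> \<le> 0 then h \<zeta> else reflect (h (- cnj \<zeta>)))" for \<zeta>
  have fixed: "reflect (h \<zeta>) = h \<zeta>" if "Re \<zeta> = 0" for \<zeta>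
  proof -
    have "\<zeta> = \<i> * of_real (Im \<zeta>)" using that by (simp add: complex_eq_iff)
    then have "Re (h \<zeta>) = bd (Im (h \<zeta>))" using bd_Im by metis
    then show ?thesis by (simp add: reflect_def height_0)
  qed
  have creflect: "continuous_on S reflect" for S
    unfolding reflect_def by (intro continuous_intros continuous_on_height)
  have H2: "H \<zeta> = reflect (h (- cnj \<zeta>))" if "0 \<le> Re \<zeta>" for \<zeta>
  proof (cases "Re \<zeta> = 0")
    case True
    then have "- cnj \<zeta> = \<zeta>" by (simp add: complex_eq_iff)
    then show ?thesis using True fixed by (simp add: H_def)
  qed (use that in \<open>simp add: H_def\<close>)
  have 1: "H \<zeta> = h \<zeta>" if "Re \<zeta> \<le> 0" for \<zeta> using that by (simp add: H_def)
  have 2: "continuous_on UNIV H"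
  proof -
    have "continuous_on {\<zeta>. Re \<zeta> \<le> 0} H" using cont by (rule continuous_on_eq) (simp add: H_def)
    moreover have "continuous_on {\<zeta>. 0 \<le> Re \<zeta>} (\<lambda>\<zeta>. reflect (h (- cnj \<zeta>)))"
      by (intro continuous_on_compose2[OF creflect[of UNIV]] continuous_on_compose2[OF cont] continuous_intros) auto
    then have "continuous_on {\<zeta>. 0 \<le> Re \<zeta>} H" by (rule continuous_on_eq) (simp add: H2)
    ultimately have "continuous_on ({\<zeta>. Re \<zeta> \<le> 0} \<union> {\<zeta>. 0 \<le> Re \<zeta>}) H"
      by (intro continuous_on_closed_Un closed_halfspace_Re_le closed_halfspace_Re_ge)
    moreover have "{\<zeta>. Re \<zeta> \<le> 0} \<union> {\<zeta>. 0 \<le> Re \<zeta>} = UNIV" by auto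
    ultimately show ?thesis by simp
  qed
  have above: "bd (Im (H \<zeta>)) < Re (H \<zeta>)" if "0 < Re \<zeta>" for \<zeta>
    using reflect_above[OF below_bd[of "- cnj \<zeta>"]] that by (simp add: H2)
  have below: "Re (H \<zeta>) \<le> bd (Im (H \<zeta>))" if "Re \<zeta> \<le> 0" for \<zeta>
  proof (cases "Re \<zeta> = 0")
    case True
    have "\<zeta> = \<i> * of_real (Im \<zeta>)" using True by (simp add: complex_eq_iff)
    then have "Re (h \<zeta>) = bd (Im (h \<zeta>))" using bd_Im by metis
    then show ?thesis using that by (simp add: H_def)
  next
    case False
    then show ?thesis using below_bd[of \<zeta>] that by (simp add: H_def)
  qed
  have 3: "inj H"
  proof (rule injI)
    fix a b assume eq: "H a = H b"
    consider "Re a \<le> 0" "Re b \<le> 0" | "Re a > 0" "Re b > 0" | "Re a \<le> 0" "Re b > 0" | "Re a > 0" "Re b \<le> 0"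
      by linarith
    then show "a = b"
    proof cases
      case 1
      then show ?thesis using eq inj_onD[OF inj_on_closed_half_plane, of a b] by (simp add: H_def)
    next
      case 2
      then have "h (- cnj a) = h (- cnj b)" using eq injD[OF inj_reflect] by (simp add: H_def)
      then have "- cnj a = - cnj b"
        using inj_onD[OF inj_on_closed_half_plane, of "- cnj a" "- cnj b"] 2 by simp
      then show ?thesis by (simp add: complex_eq_iff)
    next
      case 3
      then show ?thesis using above[of b] below[of a] eq by simp
    next
      case 4
      then show ?thesis using above[of a] below[of b] eq by simp
    qed
  qed
  have shift: "reflect (w + 2 * pi * \<i> * cis (- lam)) = reflect w + 2 * pi * \<i> * cis (- lam)" for w
    using height_translate[of "2 * pi * \<i> * cis (- lam)" w] bd_period by (simp add: reflect_def)
  have 4: "H (\<zeta> + 2 * pi * \<i>) = H \<zeta> + 2 * pi * \<i> * cis (- lam)" for \<zeta>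
  proof (cases "Re \<zeta> \<le> 0")
    case True then show ?thesis using period[of \<zeta>] by (simp add: H_def)
  next
    case False
    have "- cnj (\<zeta> + 2 * pi * \<i>) = - cnj \<zeta> + 2 * pi * \<i>" by (simp add: complex_eq_iff)
    then show ?thesis using False period[of "- cnj \<zeta>"] shift[of "h (- cnj \<zeta>)"] by (simp add: H_def)
  qed
  have 5: "\<exists>\<mu> \<nu>. (H has_derivative (\<lambda>d. \<mu> * d + \<nu> * cnj d)) (at \<zeta>)
      \<and> cmod \<nu> \<le> sin \<beta> * cmod \<mu> \<and> cmod \<mu> \<le> 2 * (1 + tan \<beta>) * cmod (h' (- cnj \<zeta>))" if pos: "0 < Re \<zeta>" for \<zeta>
  proof -
    let ?z = "- cnj \<zeta>"
    have neg: "Re ?z < 0" using pos by simp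
    obtain \<mu> \<nu> where r: "(reflect has_derivative (\<lambda>d. \<mu> * d + \<nu> * cnj d)) (at (h ?z))"
      "cmod \<mu> \<le> sin \<beta> * cmod \<nu>" "cmod \<nu> \<le> 2 * (1 + tan \<beta>)"
      using reflect_has_derivative[OF below_bd[OF neg]] .
    have "(h has_derivative (*) (h' ?z)) (at ?z)"
      using deriv[OF neg] by (simp add: has_field_derivative_def)
    moreover have "((\<lambda>\<zeta>. - cnj \<zeta>) has_derivative (\<lambda>d. - cnj d)) (at \<zeta>)"
      by (intro has_derivative_minus bounded_linear_imp_has_derivative bounded_linear_cnj)
    ultimately have "((\<lambda>\<zeta>. h (- cnj \<zeta>)) has_derivative (\<lambda>d. h' ?z * (- cnj d))) (at \<zeta>)"
      by (rule has_derivative_compose[rotated])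
    from has_derivative_compose[OF this r(1)]
    have "((\<lambda>\<zeta>. reflect (h (- cnj \<zeta>))) has_derivative
        (\<lambda>d. (- \<nu> * cnj (h' ?z)) * d + (- \<mu> * h' ?z) * cnj d)) (at \<zeta>)"
      by (simp add: algebra_simps)
    then have "(H has_derivative (\<lambda>d. (- \<nu> * cnj (h' ?z)) * d + (- \<mu> * h' ?z) * cnj d)) (at \<zeta>)"
      by (rule has_derivative_transform_within_open[OF _ open_halfspace_Re_gt[of 0]])
         (use pos in \<open>simp_all add: H_def\<close>)
    moreover have "cmod (- \<mu> * h' ?z) \<le> sin \<beta> * cmod (- \<nu> * cnj (h' ?z))"
      using mult_right_mono[OF r(2), of "cmod (h' ?z)"] by (simp add: norm_mult mult.assoc)
    moreover have "cmod (- \<nu> * cnj (h' ?z)) \<le> 2 * (1 + tan \<beta>) * cmod (h' ?z)"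
      using mult_right_mono[OF r(3), of "cmod (h' ?z)"] by (simp add: norm_mult)
    ultimately show ?thesis by blast
  qed
  have 6: "Re \<zeta> / 3 - 5 * M \<le> Re (cis lam * H \<zeta>)" if pos: "0 < Re \<zeta>" for \<zeta>
  proof -
    let ?z = "- cnj \<zeta>"
    define w where "w = h ?z"
    have neg: "Re ?z < 0" using pos by simp
    have "cis lam * cis (- lam) = 1" by (simp add: cis_mult)
    then have "cis lam * w - ?z = cis lam * (w - cis (- lam) * ?z)"
      by (metis mult.assoc mult_1 right_diff_distrib)
    then have "cmod (cis lam * w - ?z) = cmod (cis lam * (w - cis (- lam) * ?z))" by (rule arg_cong)
    also have "\<dots> \<le> M" using near[of ?z] neg by (simp add: norm_mult w_def)
    finally have "\<bar>Re (cis lam * w - ?z)\<bar> \<le> M" by (rule order_trans[OF abs_Re_le_cmod])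
    then have a: "\<bar>cos lam * Re w - sin lam * Im w + Re \<zeta>\<bar> \<le> M" by simp
    \<comment> \<open>Up to bounded terms, \<open>cos lam * (bd (Im w) - Re w)\<close> is \<open>Re \<zeta>\<close>; twice two thirds of
      it outweighs the contribution \<open>- Re \<zeta>\<close> of \<open>w\<close> itself.\<close>
    have "2 / 3 * (bd (Im w) - Re w) \<le> height w"
      using height_ge[of w] below_bd[OF neg] by (simp add: w_def)
    then have "cos lam * (2 / 3 * (bd (Im w) - Re w)) \<le> cos lam * height w"
      using cos_lam by (intro mult_left_mono) auto
    then have b: "2 / 3 * (cos lam * bd (Im w) - cos lam * Re w) \<le> cos lam * height w"
      by (simp add: algebra_simps)
    have "Re (cis lam * H \<zeta>) = (cos lam * Re w - sin lam * Im w) + 2 * (cos lam * height w)"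
      using pos by (simp add: H_def w_def[symmetric] reflect_def algebra_simps)
    then show ?thesis using a b bd_near[of "Im w"] by (simp add: abs_le_iff)
  qed
  show thesis using that[OF 1 2 3 4 5 6] .
qed

end

section \<open>Boundary values of strongly spirallike functions\<close>

lemma open_sector_rotate:
  assumes "w \<in> open_sector lam \<delta>"
  obtains s \<psi> where "0 < s" "\<bar>\<psi>\<bar> < \<delta>" "cis (- lam) * w = of_real s * cis \<psi>"
proof -
  obtain s \<phi> where "w = of_real s * cis \<phi>" "0 < s" "\<bar>\<phi> - lam\<bar> < \<delta>"
    using assms by (auto simp: open_sector_def)
  moreover have "cis (- lam) * (of_real s * cis \<phi>) = of_real s * cis (\<phi> - lam)"
    by (simp add: mult.left_commute cis_mult)
  ultimately show thesis using that by metis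
qed

lemma open_sector_Re_Im:
  assumes "w \<in> open_sector lam \<delta>" "\<delta> < pi / 2"
  shows "0 < Re (cis (- lam) * w)" "\<bar>Im (cis (- lam) * w)\<bar> \<le> tan \<delta> * Re (cis (- lam) * w)"
proof -
  obtain s \<psi> where s: "0 < s" "\<bar>\<psi>\<bar> < \<delta>" "cis (- lam) * w = of_real s * cis \<psi>"
    using open_sector_rotate[OF assms(1)] .
  have c: "0 < cos \<psi>" using s(2) assms(2) by (intro cos_gt_zero_pi) auto
  show "0 < Re (cis (- lam) * w)" unfolding s(3) using s(1) c by simp
  have "tan \<psi> < tan \<delta>" "tan (- \<psi>) < tan \<delta>"
    by (rule tan_monotone; use s(2) assms(2) in linarith)+
  then have "\<bar>tan \<psi>\<bar> \<le> tan \<delta>" by (simp add: abs_le_iff)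
  then have "\<bar>tan \<psi>\<bar> * (s * cos \<psi>) \<le> tan \<delta> * (s * cos \<psi>)"
    using s c by (intro mult_right_mono) auto
  moreover have "\<bar>tan \<psi>\<bar> * (s * cos \<psi>) = \<bar>s * sin \<psi>\<bar>" using s c by (simp add: tan_def abs_mult)
  ultimately show "\<bar>Im (cis (- lam) * w)\<bar> \<le> tan \<delta> * Re (cis (- lam) * w)"
    unfolding s(3) by simp
qed

text \<open>
  The Cayley transform with pole at \<open>- cnj (g 0)\<close> carries \<open>g\<close> to a function to which the Schwarz
  lemma applies.
\<close>
lemma norm_le_of_Re_pos:
  assumes hol: "g holomorphic_on ball 0 1" and pos: "\<And>z. z \<in> ball 0 1 \<Longrightarrow> 0 < Re (g z)"
    and z: "cmod z < 1"
  shows "cmod (g z) \<le> 2 * cmod (g 0) / (1 - cmod z)"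
proof -
  define \<omega> where "\<omega> z = (g z - g 0) / (g z + cnj (g 0))" for z
  have g0: "0 < Re (g 0)" using pos[of 0] by simp
  have den: "g z + cnj (g 0) \<noteq> 0" if "z \<in> ball 0 1" for z
    using pos[OF that] g0 by (auto simp: complex_eq_iff)
  have lt: "cmod (\<omega> z) < 1" if "cmod z < 1" for z
  proof -
    have p: "0 < Re (g z)" using pos that by simp
    have "(cmod (g z - g 0))\<^sup>2 < (cmod (g z + cnj (g 0)))\<^sup>2"
      using p g0 unfolding cmod_power2 by (simp add: power2_eq_square algebra_simps add_pos_pos)
    then have "cmod (g z - g 0) < cmod (g z + cnj (g 0))" by (rule power2_less_imp_less) simp
    then show ?thesis using den[of z] that by (simp add: \<omega>_def norm_divide)
  qed
  have hol\<omega>: "\<omega> holomorphic_on ball 0 1"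
    unfolding \<omega>_def by (intro holomorphic_intros hol) (use den in auto)
  have w: "cmod (\<omega> z) \<le> cmod z"
    by (rule Schwarz_Lemma(1)[OF hol\<omega> _ lt z]) (simp add: \<omega>_def)
  have "\<omega> z * (g z + cnj (g 0)) = g z - g 0" using den[of z] z by (simp add: \<omega>_def)
  then have "g z * (1 - \<omega> z) = g 0 + cnj (g 0) * \<omega> z" by (simp add: algebra_simps)
  then have "cmod (g z) * cmod (1 - \<omega> z) = cmod (g 0 + cnj (g 0) * \<omega> z)"
    by (metis norm_mult)
  also have "\<dots> \<le> cmod (g 0) + cmod (g 0) * cmod (\<omega> z)"
    by (rule order_trans[OF norm_triangle_ineq]) (simp add: norm_mult)
  also have "\<dots> \<le> cmod (g 0) + cmod (g 0) * 1"
    using w z by (intro add_left_mono mult_left_mono) auto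
  finally have 1: "cmod (g z) * cmod (1 - \<omega> z) \<le> 2 * cmod (g 0)" by simp
  have "1 - cmod z \<le> cmod (1 - \<omega> z)"
    using norm_triangle_ineq2[of 1 "\<omega> z"] w by simp
  then have "cmod (g z) * (1 - cmod z) \<le> 2 * cmod (g 0)"
    using 1 by (meson mult_left_mono norm_ge_zero order_trans)
  then show ?thesis using z by (simp add: pos_le_divide_eq)
qed

text \<open>
  The power \<open>1 / a\<close> opens the sector of angle \<open>pi * a\<close> to a half-plane.
\<close>
lemma norm_le_of_open_sector:
  assumes hol: "p holomorphic_on ball 0 1"
    and sector: "\<And>z. z \<in> ball 0 1 \<Longrightarrow> p z \<in> open_sector lam (pi * a / 2)"
    and a: "0 < a" "a < 1" and z: "cmod z < 1"
  shows "cmod (p z) \<le> (2 / (1 - cmod z)) powr a * cmod (p 0)"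
proof -
  define g where "g z = exp (Ln (cis (- lam) * p z) / of_real a)" for z
  have key: "cis (- lam) * p z \<notin> \<real>\<^sub>\<le>\<^sub>0 \<and> 0 < Re (g z) \<and> cmod (g z) = cmod (p z) powr (1 / a)"
    if zb: "z \<in> ball 0 1" for z
  proof -
    obtain s \<psi> where s: "0 < s" "\<bar>\<psi>\<bar> < pi * a / 2" "cis (- lam) * p z = of_real s * cis \<psi>"
      using open_sector_rotate[OF sector[OF zb]] .
    have pa: "pi * a < pi" using a by simp
    have c: "0 < cos \<psi>" by (rule cos_gt_zero_pi; use s(2) pa in linarith)
    have 1: "cis (- lam) * p z \<notin> \<real>\<^sub>\<le>\<^sub>0"
      unfolding s(3) using s(1) c by (auto simp: complex_nonpos_Reals_iff mult_le_0_iff)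
    have "of_real s * cis \<psi> = exp (of_real (ln s) + \<i> * of_real \<psi>)"
      using s(1) by (simp add: exp_add cis_conv_exp exp_of_real)
    moreover have "Ln (exp (of_real (ln s) + \<i> * of_real \<psi>)) = of_real (ln s) + \<i> * of_real \<psi>"
    proof (rule Ln_exp)
      have "\<bar>\<psi>\<bar> < pi" using s(2) pa pi_gt_zero by linarith
      then show "- pi < Im (of_real (ln s) + \<i> * of_real \<psi>)" "Im (of_real (ln s) + \<i> * of_real \<psi>) \<le> pi"
        by (auto simp: abs_less_iff)
    qed
    ultimately have L: "Ln (cis (- lam) * p z) = of_real (ln s) + \<i> * of_real \<psi>" using s(3) by simp
    have gz: "g z = exp (of_real (ln s / a) + \<i> * of_real (\<psi> / a))"
      unfolding g_def L by (simp add: add_divide_distrib)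
    have "\<bar>\<psi> / a\<bar> < pi / 2" using s(2) a by (simp add: abs_divide field_simps)
    then have "0 < cos (\<psi> / a)" by - (rule cos_gt_zero_pi; linarith)
    then have 2: "0 < Re (g z)" unfolding gz by (simp add: Re_exp)
    have "cmod (p z) = cmod (cis (- lam) * p z)" by (simp add: norm_mult)
    also have "\<dots> = s" unfolding s(3) using s(1) by (simp add: norm_mult)
    finally have "cmod (g z) = cmod (p z) powr (1 / a)"
      unfolding gz using s(1) by (simp add: norm_exp_eq_Re powr_def)
    with 1 2 show ?thesis by blast
  qed
  have "g holomorphic_on ball 0 1"
    unfolding g_def by (intro holomorphic_intros hol) (use key a in auto)
  from norm_le_of_Re_pos[OF this _ z] key
  have "cmod (g z) \<le> 2 * cmod (g 0) / (1 - cmod z)" by blast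
  then have "cmod (p z) powr (1 / a) \<le> 2 / (1 - cmod z) * cmod (p 0) powr (1 / a)"
    using key[of z] key[of 0] z by simp
  then have "(cmod (p z) powr (1 / a)) powr a \<le> (2 / (1 - cmod z) * cmod (p 0) powr (1 / a)) powr a"
    using a by (intro powr_mono2) auto
  also have "\<dots> = (2 / (1 - cmod z)) powr a * (cmod (p 0) powr (1 / a)) powr a"
    by (rule powr_mult)
  finally show ?thesis using a by (simp add: powr_powr)
qed

text \<open>
  If the derivative grows more slowly than the reciprocal distance to the circle, the dilations
  \<open>q (r * z)\<close> converge uniformly on the closed disk as \<open>r\<close> tends to 1.
\<close>
lemma ball_continuous_extension:
  fixes q :: "complex \<Rightarrow> complex"
  assumes hol: "q holomorphic_on ball 0 1" and a: "0 < a" "a < 1" and C: "0 \<le> C"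
    and bound: "\<And>z. cmod z < 1 \<Longrightarrow> cmod (deriv q z) \<le> C * (1 - cmod z) powr (- a)"
  obtains Q where "continuous_on (cball 0 1) Q" "\<And>z. cmod z < 1 \<Longrightarrow> Q z = q z"
proof -
  define K where "K = C / (1 - a)"
  have K: "0 \<le> K" using C a by (simp add: K_def)
  have radial: "cmod (q (of_real s * z) - q (of_real r * z)) \<le> K * (1 - r) powr (1 - a)"
    if rs: "0 \<le> r" "r < s" "s < 1" and z: "cmod z \<le> 1" for r s z
  proof -
    have small: "cmod (of_real t * z) < 1" if "0 \<le> t" "t < 1" for t :: real
    proof -
      have "cmod (of_real t * z) \<le> t * 1" using that z by (simp add: norm_mult mult_left_le)
      then show ?thesis using that by simp
    qed
    have "cmod (q (of_real s * z) - q (of_real r * z))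
       \<le> (- K * (1 - s) powr (1 - a)) - (- K * (1 - r) powr (1 - a))"
    proof (rule differentiable_bound_general[where f = "\<lambda>t. q (of_real t * z)"
          and f' = "\<lambda>t. z * deriv q (of_real t * z)" and \<phi>' = "\<lambda>t. C * (1 - t) powr (- a)", OF \<open>r < s\<close>])
      show "continuous_on {r..s} (\<lambda>t. q (of_real t * z))"
        by (intro continuous_on_compose2[OF holomorphic_on_imp_continuous_on[OF hol]] continuous_intros)
           (use small rs in auto)
      show "continuous_on {r..s} (\<lambda>t. - K * (1 - t) powr (1 - a))"
        using rs by (intro continuous_intros) auto
      fix t assume t: "r < t" "t < s"
      then have t1: "cmod (of_real t * z) < 1" using small rs by simp
      have "((\<lambda>t. of_real t * z) has_vector_derivative z) (at t)"
        by (auto intro!: derivative_eq_intros simp: has_vector_derivative_def scaleR_conv_of_real)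
      moreover have "(q has_field_derivative deriv q (of_real t * z)) (at (of_real t * z))"
        using holomorphic_derivI[OF hol open_ball, of "of_real t * z"] t1 by simp
      ultimately show "((\<lambda>t. q (of_real t * z)) has_vector_derivative z * deriv q (of_real t * z)) (at t)"
        using field_vector_diff_chain_at[of "\<lambda>t. of_real t * z"] by (simp add: o_def)
      have "((\<lambda>t. - K * (1 - t) powr (1 - a)) has_real_derivative - K * ((1 - a) * (1 - t) powr (1 - a - 1) * (- 1))) (at t)"
        using t rs by (auto intro!: derivative_eq_intros)
      then have "((\<lambda>t. - K * (1 - t) powr (1 - a)) has_real_derivative C * (1 - t) powr (- a)) (at t)"
        by (rule DERIV_cong) (use a in \<open>simp add: K_def\<close>)
      then show "((\<lambda>t. - K * (1 - t) powr (1 - a)) has_vector_derivative C * (1 - t) powr (- a)) (at t)"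
        unfolding has_real_derivative_iff_has_vector_derivative .
      have "cmod (z * deriv q (of_real t * z)) \<le> 1 * cmod (deriv q (of_real t * z))"
        unfolding norm_mult using z by (intro mult_right_mono) auto
      also have "\<dots> \<le> C * (1 - cmod (of_real t * z)) powr (- a)" using bound[OF t1] by simp
      also have "\<dots> \<le> C * (1 - t) powr (- a)"
      proof (intro mult_left_mono C powr_mono2')
        show "1 - t \<le> 1 - cmod (of_real t * z)"
          using t rs z by (simp add: norm_mult mult_left_le)
      qed (use t rs a in auto)
      finally show "norm (z * deriv q (of_real t * z)) \<le> C * (1 - t) powr (- a)" .
    qed
    also have "\<dots> \<le> K * (1 - r) powr (1 - a)" using K by simp
    finally show ?thesis .
  qed
  define r where "r n = 1 - inverse (real (Suc n))" for n
  have r: "0 \<le> r n" "r n < 1" for n by (auto simp: r_def field_simps)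
  have r_mono: "r m < r n" if "m < n" for m n using that by (simp add: r_def)
  have rlim: "r \<longlonglongrightarrow> 1"
    unfolding r_def using tendsto_diff[OF tendsto_const LIMSEQ_inverse_real_of_nat] by simp
  have tail: "(\<lambda>n. K * (1 - r n) powr (1 - a)) \<longlonglongrightarrow> 0"
  proof -
    have "(\<lambda>n. (1 - r n) powr (1 - a)) \<longlonglongrightarrow> 0"
      using tendsto_powr'[of "\<lambda>n. 1 - r n" 0 sequentially "\<lambda>_. 1 - a" "1 - a"] tendsto_diff[OF tendsto_const rlim, of 1] a
      by (auto intro!: always_eventually less_imp_le[OF r(2)])
    from tendsto_mult_left[OF this, of K] show ?thesis by simp
  qed
  have "uniformly_Cauchy_on (cball 0 1) (\<lambda>n z. q (of_real (r n) * z))"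
  proof (rule uniformly_Cauchy_onI')
    fix e :: real assume "0 < e"
    then obtain N where N: "\<And>n. N \<le> n \<Longrightarrow> K * (1 - r n) powr (1 - a) < e"
      using order_tendstoD(2)[OF tail] by (auto simp: eventually_sequentially)
    have "dist (q (of_real (r m) * z)) (q (of_real (r n) * z)) < e"
      if "z \<in> cball 0 1" "N \<le> m" "m < n" for z m n
      using radial[OF r(1) r_mono[OF that(3)] r(2), of z] N[OF that(2)] that(1)
      by (simp add: dist_norm norm_minus_commute)
    then show "\<exists>N. \<forall>z\<in>cball 0 1. \<forall>m\<ge>N. \<forall>n>m. dist (q (of_real (r m) * z)) (q (of_real (r n) * z)) < e"
      by blast
  qed
  then obtain Q where Q: "uniform_limit (cball 0 1) (\<lambda>n z. q (of_real (r n) * z)) Q sequentially"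
    using Cauchy_uniformly_convergent unfolding uniformly_convergent_on_def by blast
  have small: "of_real (r n) * z \<in> ball 0 1" if "z \<in> cball 0 1" for n and z :: complex
  proof -
    have "cmod (of_real (r n) * z) \<le> r n * 1" using that r[of n] by (simp add: norm_mult mult_left_le)
    then show ?thesis using r(2)[of n] by simp
  qed
  have "continuous_on (cball 0 1) Q"
  proof (rule uniform_limit_theorem[OF _ Q])
    have "continuous_on (cball 0 1) (\<lambda>z. q (of_real (r n) * z))" for n
      by (rule continuous_on_compose2[OF holomorphic_on_imp_continuous_on[OF hol]])
         (use small in \<open>auto intro!: continuous_intros\<close>)
    then show "\<forall>\<^sub>F n in sequentially. continuous_on (cball 0 1) (\<lambda>z. q (of_real (r n) * z))" by simp
  qed simp
  moreover have "Q z = q z" if "cmod z < 1" for z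
  proof (rule LIMSEQ_unique)
    show "(\<lambda>n. q (of_real (r n) * z)) \<longlonglongrightarrow> Q z"
      using tendsto_uniform_limitI[OF Q] that by simp
    have "(\<lambda>n. of_real (r n) * z) \<longlonglongrightarrow> of_real 1 * z"
      by (intro tendsto_intros rlim)
    moreover have "isCont q z"
      using hol that holomorphic_on_imp_continuous_on continuous_on_interior[of "ball 0 1" q z] by simp
    ultimately show "(\<lambda>n. q (of_real (r n) * z)) \<longlonglongrightarrow> q z"
      using isCont_tendsto_compose[of z q] by simp
  qed
  ultimately show thesis by (rule that)
qed

lemma strongly_spirallike_log:
  assumes "strongly_spirallike_at lam a f"
  obtains q where "q holomorphic_on ball 0 1" "\<And>z. z \<in> ball 0 1 \<Longrightarrow> f z = z * exp (q z)"
    "\<And>z. z \<in> ball 0 1 \<Longrightarrow> 1 + z * deriv q z \<in> open_sector lam (pi * a / 2)"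
proof -
  have f: "f holomorphic_on ball 0 1" "f 0 = 0" "deriv f 0 \<noteq> 0" "\<And>z. z \<in> ball 0 1 - {0} \<Longrightarrow> f z \<noteq> 0"
    and sec: "\<And>z. z \<in> ball 0 1 \<Longrightarrow> (if z = 0 then 1 else z * deriv f z / f z) \<in> open_sector lam (pi * a / 2)"
    using assms analytic_imp_holomorphic unfolding strongly_spirallike_at_def by auto
  define g where "g z = (if z = 0 then deriv f 0 else (f z - f 0) / (z - 0))" for z
  have "g holomorphic_on ball 0 1" unfolding g_def[abs_def] by (rule pole_lemma_open[OF f(1) open_ball])
  moreover have "g z \<noteq> 0" if "z \<in> ball 0 1" for z using f that by (auto simp: g_def)
  ultimately obtain q where q: "q holomorphic_on ball 0 1" "\<And>z. z \<in> ball 0 1 \<Longrightarrow> exp (q z) = g z"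
    by (rule holomorphic_logarithm_exists[OF convex_ball open_ball, where ?z0.0 = 0]) auto
  have fq: "f z = z * exp (q z)" if "z \<in> ball 0 1" for z
    using q(2)[OF that] f(2) by (simp add: g_def)
  have "1 + z * deriv q z \<in> open_sector lam (pi * a / 2)" if z: "z \<in> ball 0 1" for z
  proof (cases "z = 0")
    case True then show ?thesis using sec[of 0] by simp
  next
    case False
    have "(q has_field_derivative deriv q z) (at z)" using holomorphic_derivI[OF q(1) open_ball z] by simp
    then have "((\<lambda>z. z * exp (q z)) has_field_derivative exp (q z) * (1 + z * deriv q z)) (at z)"
      by (auto intro!: derivative_eq_intros simp: algebra_simps)
    then have "(f has_field_derivative exp (q z) * (1 + z * deriv q z)) (at z)"
      by (rule has_field_derivative_transform_within_open[OF _ open_ball z]) (simp add: fq)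
    then have "z * deriv f z / f z = 1 + z * deriv q z"
      using False fq[OF z] by (simp add: DERIV_imp_deriv)
    then show ?thesis using sec[OF z] False by simp
  qed
  then show thesis using that q(1) fq by blast
qed

text \<open>
  Logarithmic representation: with \<open>Q' = deriv Q\<close> inside the disk, \<open>1 + z * Q' z\<close> is
  \<open>z * deriv f z / f z\<close>, filled with the value 1 at the origin.
\<close>
lemma strongly_spirallike_representation:
  assumes f: "strongly_spirallike_at lam a f" and a: "0 < a" "a < 1"
  obtains Q Q' where "continuous_on (cball 0 1) Q"
    "\<And>z. cmod z < 1 \<Longrightarrow> f z = z * exp (Q z)"
    "\<And>z. cmod z < 1 \<Longrightarrow> (Q has_field_derivative Q' z) (at z)"
    "\<And>z. cmod z < 1 \<Longrightarrow> 1 + z * Q' z \<in> open_sector lam (pi * a / 2)"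
    "\<And>z. cmod z < 1 \<Longrightarrow> cmod (1 + z * Q' z) \<le> 2 * (1 - cmod z) powr (- a)"
proof -
  obtain q where q: "q holomorphic_on ball 0 1" and fq: "\<And>z. z \<in> ball 0 1 \<Longrightarrow> f z = z * exp (q z)"
    and sec: "\<And>z. z \<in> ball 0 1 \<Longrightarrow> 1 + z * deriv q z \<in> open_sector lam (pi * a / 2)"
    using strongly_spirallike_log[OF f] by blast
  define p where "p z = 1 + z * deriv q z" for z
  have p_hol: "p holomorphic_on ball 0 1"
    unfolding p_def by (intro holomorphic_intros holomorphic_deriv q) auto
  have p_bound: "cmod (p z) \<le> (2 / (1 - cmod z)) powr a" if "cmod z < 1" for z
    using norm_le_of_open_sector[OF p_hol _ a that, of lam] sec by (simp add: p_def)
  have p_bound': "cmod (p z) \<le> 2 * (1 - cmod z) powr (- a)" if "cmod z < 1" for z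
  proof -
    have "2 powr a \<le> 2 powr (1::real)" using a by (intro powr_mono) auto
    then have "2 powr a * (1 - cmod z) powr (- a) \<le> 2 * (1 - cmod z) powr (- a)"
      by (intro mult_right_mono) auto
    moreover have "(2 / (1 - cmod z)) powr a = 2 powr a * (1 - cmod z) powr (- a)"
      using that by (simp add: powr_divide powr_minus_divide)
    ultimately show ?thesis using p_bound[OF that] by linarith
  qed
  have "\<exists>C\<ge>0. \<forall>z. cmod z < 1 \<longrightarrow> cmod (deriv q z) \<le> C * (1 - cmod z) powr (- a)"
  proof -
    \<comment> \<open>Dividing by \<open>z\<close> is harmless for \<open>cmod z \<ge> 1 / 2\<close>; the rest is compact.\<close>
    have "compact (deriv q ` cball 0 (1 / 2))"
      by (intro compact_continuous_image holomorphic_on_imp_continuous_on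
            holomorphic_on_subset[OF holomorphic_deriv[OF q open_ball]]) auto
    then obtain B where B: "\<And>z. cmod z \<le> 1 / 2 \<Longrightarrow> cmod (deriv q z) \<le> B"
      by (force dest!: compact_imp_bounded simp: bounded_iff)
    have one: "1 \<le> (1 - cmod z) powr (- a)" if "cmod z < 1" for z
      using powr_mono2'[of "- a" "1 - cmod z" 1] that a by simp
    have "cmod (deriv q z) \<le> (\<bar>B\<bar> + 6) * (1 - cmod z) powr (- a)" if z: "cmod z < 1" for z
    proof (cases "cmod z \<le> 1 / 2")
      case True
      have "cmod (deriv q z) \<le> (\<bar>B\<bar> + 6) * 1" using B[OF True] by simp
      also have "\<dots> \<le> (\<bar>B\<bar> + 6) * (1 - cmod z) powr (- a)"
        using one[OF z] by (intro mult_left_mono) auto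
      finally show ?thesis .
    next
      case False
      have "cmod z * cmod (deriv q z) = cmod (p z - 1)" by (simp add: p_def norm_mult)
      also have "\<dots> \<le> cmod (p z) + 1" using norm_triangle_ineq4[of "p z" 1] by simp
      also have "\<dots> \<le> 3 * (1 - cmod z) powr (- a)" using p_bound'[OF z] one[OF z] by simp
      finally have "cmod z * cmod (deriv q z) \<le> 3 * (1 - cmod z) powr (- a)" .
      moreover have "1 / 2 * cmod (deriv q z) \<le> cmod z * cmod (deriv q z)"
        using False by (intro mult_right_mono) auto
      ultimately have "cmod (deriv q z) \<le> 6 * (1 - cmod z) powr (- a)" by simp
      also have "\<dots> \<le> (\<bar>B\<bar> + 6) * (1 - cmod z) powr (- a)" by (intro mult_right_mono) auto
      finally show ?thesis .
    qed
    then show ?thesis by (intro exI[of _ "\<bar>B\<bar> + 6"]) auto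
  qed
  then obtain C where C: "0 \<le> C" "\<And>z. cmod z < 1 \<Longrightarrow> cmod (deriv q z) \<le> C * (1 - cmod z) powr (- a)"
    by blast
  obtain Q where Q: "continuous_on (cball 0 1) Q" "\<And>z. cmod z < 1 \<Longrightarrow> Q z = q z"
    using ball_continuous_extension[OF q a C] by blast
  have Q': "(Q has_field_derivative deriv q z) (at z)" if "cmod z < 1" for z
  proof -
    have "(q has_field_derivative deriv q z) (at z)"
      using holomorphic_derivI[OF q open_ball, of z] that by simp
    then show ?thesis
      by (rule has_field_derivative_transform_within_open[OF _ open_ball, of _ _ _ 0 1])
         (use that Q(2) in auto)
  qed
  show thesis
    by (rule that[of Q "deriv q"]) (use Q Q' fq sec p_bound' in \<open>auto simp: p_def\<close>)
qed

section \<open>The quasiconformal extension\<close>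

lemma strongly_spirallike_at_extension:
  fixes f :: "complex \<Rightarrow> complex" and lam a :: real
  assumes a: "0 < a" "a < 1" and lam: "- pi / 2 < lam" "lam < pi / 2"
    and f: "strongly_spirallike_at lam a f"
  shows "\<exists>F. quasiconformal (sin (pi * a / 2)) F \<and> (\<forall>z\<in>ball 0 1. F z = f z)"
proof -
  define \<beta> where "\<beta> = pi * a / 2"
  have beta: "0 < \<beta>" "\<beta> < pi / 2" using a by (auto simp: \<beta>_def)
  obtain Q Q' where Q: "continuous_on (cball 0 1) Q" and fQ: "\<And>z. cmod z < 1 \<Longrightarrow> f z = z * exp (Q z)"
    and Q': "\<And>z. cmod z < 1 \<Longrightarrow> (Q has_field_derivative Q' z) (at z)"
    and sec: "\<And>z. cmod z < 1 \<Longrightarrow> 1 + z * Q' z \<in> open_sector lam (pi * a / 2)"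
    and bd: "\<And>z. cmod z < 1 \<Longrightarrow> cmod (1 + z * Q' z) \<le> 2 * (1 - cmod z) powr (- a)"
    using strongly_spirallike_representation[OF f a] by blast
  define p where "p z = 1 + z * Q' z" for z
  have p_bound: "cmod (p z) \<le> 2 * (1 - cmod z) powr (- a)" if "cmod z < 1" for z
    using bd[OF that] by (simp add: p_def)
  have p_Re: "0 < Re (cis (- lam) * p z)" and p_Im: "\<bar>Im (cis (- lam) * p z)\<bar> \<le> tan \<beta> * Re (cis (- lam) * p z)"
    if "cmod z < 1" for z
    using open_sector_Re_Im[of "p z" lam \<beta>] sec[of z] that beta by (auto simp: p_def \<beta>_def)
  have "compact (Q ` cball 0 1)" by (intro compact_continuous_image Q) auto
  then obtain M where M: "\<And>z. cmod z \<le> 1 \<Longrightarrow> cmod (Q z) \<le> M"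
    by (force dest!: compact_imp_bounded simp: bounded_iff)

  \<comment> \<open>In logarithmic coordinates, turned by \<open>- lam\<close>, the spirals about the origin become
    horizontal lines.\<close>
  define h where "h \<zeta> = cis (- lam) * (\<zeta> + Q (exp \<zeta>))" for \<zeta>
  define h' where "h' \<zeta> = cis (- lam) * p (exp \<zeta>)" for \<zeta>
  have exp_lt: "cmod (exp \<zeta>) < 1 \<longleftrightarrow> Re \<zeta> < 0" and exp_le: "cmod (exp \<zeta>) \<le> 1 \<longleftrightarrow> Re \<zeta> \<le> 0" for \<zeta>
    by (auto simp: norm_exp_eq_Re)
  interpret half_plane_map h h' lam \<beta> M
  proof
    show "0 < cos lam" using lam by (intro cos_gt_zero_pi) auto
    show "continuous_on {\<zeta>. Re \<zeta> \<le> 0} h"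
      unfolding h_def by (intro continuous_intros continuous_on_compose2[OF Q]) (auto simp: exp_le)
    show "(h has_field_derivative h' \<zeta>) (at \<zeta>)" if neg: "Re \<zeta> < 0" for \<zeta>
    proof -
      have "((\<lambda>\<zeta>. Q (exp \<zeta>)) has_field_derivative Q' (exp \<zeta>) * exp \<zeta>) (at \<zeta>)"
        by (rule DERIV_chain2[OF Q']) (use neg in \<open>auto simp: exp_lt intro: DERIV_exp\<close>)
      then have "((\<lambda>\<zeta>. cis (- lam) * (\<zeta> + Q (exp \<zeta>))) has_field_derivative cis (- lam) * (1 + Q' (exp \<zeta>) * exp \<zeta>)) (at \<zeta>)"
        by (intro DERIV_cmult DERIV_add DERIV_ident)
      then show ?thesis
        by (simp add: h_def[abs_def] h'_def p_def mult.commute)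
    qed
    show "h (\<zeta> + 2 * pi * \<i>) = h \<zeta> + 2 * pi * \<i> * cis (- lam)" for \<zeta>
      by (simp add: h_def exp_add algebra_simps)
    show "cmod (h \<zeta> - cis (- lam) * \<zeta>) \<le> M" if "Re \<zeta> \<le> 0" for \<zeta>
      using M[of "exp \<zeta>"] that by (simp add: h_def distrib_left norm_mult exp_le)
  qed (use beta p_Re p_Im in \<open>auto simp: h'_def exp_lt\<close>)

  obtain H where Hh: "\<And>\<zeta>. Re \<zeta> \<le> 0 \<Longrightarrow> H \<zeta> = h \<zeta>" and Hcont: "continuous_on UNIV H" and Hinj: "inj H"
    and Hper: "\<And>\<zeta>. H (\<zeta> + 2 * pi * \<i>) = H \<zeta> + 2 * pi * \<i> * cis (- lam)"
    and Hder: "\<And>\<zeta>. 0 < Re \<zeta> \<Longrightarrow> \<exists>\<mu> \<nu>. (H has_derivative (\<lambda>d. \<mu> * d + \<nu> * cnj d)) (at \<zeta>)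
        \<and> cmod \<nu> \<le> sin \<beta> * cmod \<mu> \<and> cmod \<mu> \<le> 2 * (1 + tan \<beta>) * cmod (h' (- cnj \<zeta>))"
    and Hgrow: "\<And>\<zeta>. 0 < Re \<zeta> \<Longrightarrow> Re \<zeta> / 3 - 5 * M \<le> Re (cis lam * H \<zeta>)"
    using extension by blast
  have cc: "cis lam * (cis (- lam) * x) = x" for x by (simp add: mult.assoc[symmetric] cis_mult)
  have Hper_nat: "H (\<zeta> + of_nat n * (2 * pi * \<i>)) = H \<zeta> + of_nat n * (2 * pi * \<i> * cis (- lam))" for \<zeta> n
  proof (induction n)
    case (Suc n)
    have "\<zeta> + of_nat (Suc n) * (2 * pi * \<i>) = (\<zeta> + of_nat n * (2 * pi * \<i>)) + 2 * pi * \<i>"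
      by (simp add: algebra_simps)
    then show ?case using Hper[of "\<zeta> + of_nat n * (2 * pi * \<i>)"] Suc by (simp add: algebra_simps)
  qed simp
  have Hper_int: "H (\<zeta> + of_int n * (2 * pi * \<i>)) = H \<zeta> + of_int n * (2 * pi * \<i> * cis (- lam))" for \<zeta> n
  proof (cases "n \<ge> 0")
    case True
    then show ?thesis using Hper_nat[of \<zeta> "nat n"] by simp
  next
    case False
    then show ?thesis using Hper_nat[of "\<zeta> + of_int n * (2 * pi * \<i>)" "nat (- n)"] by (simp add: algebra_simps)
  qed

  define F where "F z = (if cmod z \<le> 1 then z * exp (Q z) else exp (cis lam * H (Ln z)))" for z
  have F_exp: "F (exp \<zeta>) = exp (cis lam * H \<zeta>)" for \<zeta>
  proof (cases "Re \<zeta> \<le> 0")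
    case True
    then show ?thesis by (simp add: F_def exp_le Hh h_def cc exp_add)
  next
    case False
    obtain n :: int where "Ln (exp \<zeta>) = \<zeta> + (of_int (2 * n) * pi) * \<i>"
      using exp_eq[of "Ln (exp \<zeta>)" \<zeta>] by auto
    then have e: "Ln (exp \<zeta>) = \<zeta> + of_int n * (2 * pi * \<i>)" by simp
    have "cis lam * H (Ln (exp \<zeta>)) = cis lam * H \<zeta> + cis lam * (cis (- lam) * (of_int n * (2 * pi * \<i>)))"
      unfolding e Hper_int distrib_left by (simp only: mult_ac)
    then have "exp (cis lam * H (Ln (exp \<zeta>))) = exp (cis lam * H \<zeta>) * exp (of_int n * (2 * pi * \<i>))"
      unfolding cc by (simp only: exp_add)
    moreover have "exp (of_int n * (2 * pi * \<i>)) = 1"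
      using exp_eq[of "of_int n * (2 * pi * \<i>)" 0] by (auto intro!: exI[of _ n])
    ultimately show ?thesis using False by (simp add: F_def exp_le)
  qed
  \<comment> \<open>Near any point other than 0 a branch of the logarithm centred there can be used.\<close>
  have F_local: "F z = exp (cis lam * H (Ln (z / exp \<zeta>) + \<zeta>))" if "z \<noteq> 0" for z \<zeta>
    using F_exp[of "Ln (z / exp \<zeta>) + \<zeta>"] that by (simp add: exp_add)

  have F_cont: "continuous_on UNIV F"
  proof (rule continuous_at_imp_continuous_on, rule ballI)
    fix z0 :: complex
    show "isCont F z0"
    proof (cases "z0 = 0")
      case True
      have "continuous_on (ball 0 1) (\<lambda>z. z * exp (Q z))"
        by (intro continuous_intros continuous_on_subset[OF Q]) auto
      then have "continuous_on (ball 0 1) F"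
        by (rule continuous_on_eq) (auto simp: F_def)
      then show ?thesis using True continuous_on_interior[of "ball 0 1" F 0] by simp
    next
      case False
      define \<zeta> where "\<zeta> = Ln z0"
      have e: "exp \<zeta> = z0" using False by (simp add: \<zeta>_def)
      have "isCont (\<lambda>z. exp (cis lam * H (Ln (z / exp \<zeta>) + \<zeta>))) z0"
      proof -
        have "isCont (\<lambda>z. Ln (z / exp \<zeta>) + \<zeta>) z0"
          using False e by (intro continuous_intros) auto
        moreover have "isCont H (Ln (z0 / exp \<zeta>) + \<zeta>)"
          using Hcont by (simp add: continuous_on_eq_continuous_at)
        ultimately have "isCont (\<lambda>z. H (Ln (z / exp \<zeta>) + \<zeta>)) z0" by (rule isCont_o2)
        then show ?thesis by (intro continuous_intros)
      qed
      moreover have "\<forall>\<^sub>F z in nhds z0. F z = exp (cis lam * H (Ln (z / exp \<zeta>) + \<zeta>))"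
        using t1_space_nhds[OF False] by eventually_elim (rule F_local)
      ultimately show ?thesis by (simp only: isCont_cong)
    qed
  qed

  have F0: "F z = 0 \<longleftrightarrow> z = 0" for z by (auto simp: F_def)
  have F_inj: "inj F"
  proof (rule injI)
    fix x y assume eq: "F x = F y"
    show "x = y"
    proof (cases "x = 0 \<or> y = 0")
      case True then show ?thesis using eq F0 by metis
    next
      case False
      then obtain s t where st: "x = exp s" "y = exp t" by (metis exp_Ln)
      then have "exp (cis lam * H s) = exp (cis lam * H t)" using eq F_exp by simp
      then obtain n :: int where n: "cis lam * H s = cis lam * H t + (of_int (2 * n) * pi) * \<i>"
        unfolding exp_eq by blast
      have "H s = cis (- lam) * (cis lam * H s)" by (simp add: mult.assoc[symmetric] cis_mult)
      also have "\<dots> = cis (- lam) * (cis lam * H t) + of_int n * (2 * pi * \<i> * cis (- lam))"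
        unfolding n by (simp add: algebra_simps)
      also have "\<dots> = H (t + of_int n * (2 * pi * \<i>))"
        unfolding Hper_int by (simp add: mult.assoc[symmetric] cis_mult)
      finally have "s = t + of_int n * (2 * pi * \<i>)" using injD[OF Hinj] by blast
      then have "s = t + (of_int (2 * n) * pi) * \<i>" by simp
      then show ?thesis unfolding st exp_eq by blast
    qed
  qed

  have "\<exists>R. \<forall>z. R < cmod z \<longrightarrow> B < cmod (F z)" for B
  proof (intro exI[of _ "max 1 (exp (3 * (\<bar>B\<bar> + 5 * M)))"] allI impI)
    fix z assume z: "max 1 (exp (3 * (\<bar>B\<bar> + 5 * M))) < cmod z"
    then have z0: "z \<noteq> 0" by auto
    have Re: "Re (Ln z) = ln (cmod z)" using z0 by (rule Re_Ln)
    have "ln (exp (3 * (\<bar>B\<bar> + 5 * M))) < ln (cmod z)" using z z0 by (subst ln_less_cancel_iff) auto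
    then have big: "3 * (\<bar>B\<bar> + 5 * M) < Re (Ln z)" by (simp add: Re)
    have pos: "0 < Re (Ln z)" unfolding Re by (rule ln_gt_zero) (use z in simp)
    have "\<bar>B\<bar> \<le> Re (Ln z) / 3 - 5 * M" using big by (simp add: field_simps)
    then have "\<bar>B\<bar> \<le> Re (cis lam * H (Ln z))" by (rule order_trans[OF _ Hgrow[OF pos]])
    then have ge: "exp \<bar>B\<bar> \<le> exp (Re (cis lam * H (Ln z)))" by (simp only: exp_le_cancel_iff)
    have "B < 1 + \<bar>B\<bar>" by simp
    also have "\<dots> \<le> exp \<bar>B\<bar>" by (rule exp_ge_add_one_self)
    also note ge
    also have "exp (Re (cis lam * H (Ln z))) = cmod (F z)"
      using F_exp[of "Ln z"] exp_Ln[OF z0] norm_exp_eq_Re[of "cis lam * H (Ln z)"] by metis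
    finally show "B < cmod (F z)" .
  qed
  then have homeo: "\<exists>G. homeomorphism UNIV UNIV F G"
    by (rule homeomorphism_UNIV_of_inj_proper[OF F_cont F_inj])

  define K where "K = max 1 (2 * (1 + tan \<beta>))"
  have K: "1 \<le> K" "2 * (1 + tan \<beta>) \<le> K" by (auto simp: K_def)
  have sin0: "0 \<le> sin \<beta>" using beta by (intro sin_ge_zero) auto
  \<comment> \<open>One bound for the inside and the outside: the summand \<open>exp M\<close> and the value 1 in \<open>K\<close>
    serve the inside.\<close>
  have derF: "\<exists>\<mu> \<nu>. (F has_derivative (\<lambda>d. \<mu> * d + \<nu> * cnj d)) (at z) \<and> cmod \<nu> \<le> sin \<beta> * cmod \<mu>
      \<and> cmod \<mu> \<le> (exp M + cmod (F z)) * K * (2 * (1 + cmod z) powr a * \<bar>cmod z - 1\<bar> powr (- a))"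
    if z: "cmod z \<noteq> 1" for z
  proof (cases "cmod z < 1")
    case True
    have "((\<lambda>z. z * exp (Q z)) has_field_derivative exp (Q z) * p z) (at z)"
      by (auto intro!: derivative_eq_intros Q'[OF True] simp: p_def algebra_simps)
    then have "(F has_field_derivative exp (Q z) * p z) (at z)"
      by (rule has_field_derivative_transform_within_open[OF _ open_ball, of _ _ _ 0 1])
         (use True in \<open>auto simp: F_def\<close>)
    then have "(F has_derivative (\<lambda>d. (exp (Q z) * p z) * d + 0 * cnj d)) (at z)"
      by (simp add: has_field_derivative_def)
    moreover have "cmod (exp (Q z) * p z) \<le> (exp M + cmod (F z)) * K * (2 * (1 + cmod z) powr a * \<bar>cmod z - 1\<bar> powr (- a))"
    proof -
      have "Re (Q z) \<le> M" using M[of z] complex_Re_le_cmod[of "Q z"] True by simp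
      then have "cmod (exp (Q z)) \<le> exp M * 1" by (simp add: norm_exp_eq_Re)
      also have "\<dots> \<le> (exp M + cmod (F z)) * K" using K by (intro mult_mono) auto
      finally have "cmod (exp (Q z)) \<le> (exp M + cmod (F z)) * K" .
      moreover have "cmod (p z) \<le> 2 * (1 + cmod z) powr a * \<bar>cmod z - 1\<bar> powr (- a)"
      proof -
        have "1 \<le> (1 + cmod z) powr a" using a by (intro ge_one_powr_ge_zero) auto
        then have le: "1 * (1 - cmod z) powr (- a) \<le> (1 + cmod z) powr a * (1 - cmod z) powr (- a)"
          by (intro mult_right_mono) auto
        have "\<bar>cmod z - 1\<bar> = 1 - cmod z" using True by simp
        then show ?thesis using p_bound[OF True] le by simp
      qed
      ultimately show ?thesis unfolding norm_mult using K(1) by (intro mult_mono) auto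
    qed
    ultimately show ?thesis using sin0 by (intro exI[of _ "exp (Q z) * p z"] exI[of _ 0]) auto
  next
    case False
    then have z1: "1 < cmod z" using z by simp
    then have z0: "z \<noteq> 0" by auto
    define \<zeta> where "\<zeta> = Ln z"
    have e: "exp \<zeta> = z" using z0 by (simp add: \<zeta>_def)
    have pos: "0 < Re \<zeta>" unfolding \<zeta>_def Re_Ln[OF z0] using z1 by (rule ln_gt_zero)
    obtain \<mu> \<nu> where H: "(H has_derivative (\<lambda>d. \<mu> * d + \<nu> * cnj d)) (at \<zeta>)"
      and b: "cmod \<nu> \<le> sin \<beta> * cmod \<mu>" and g: "cmod \<mu> \<le> 2 * (1 + tan \<beta>) * cmod (h' (- cnj \<zeta>))"
      using Hder[OF pos] by blast
    have L: "((\<lambda>w. Ln (w / z) + \<zeta>) has_derivative (\<lambda>d. d / z)) (at z)"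
    proof -
      have "((\<lambda>w. Ln (w / z) + \<zeta>) has_field_derivative inverse (z / z) * (1 / z)) (at z)"
        using z0 by (auto intro!: derivative_eq_intros)
      then have "((\<lambda>w. Ln (w / z) + \<zeta>) has_field_derivative 1 / z) (at z)" using z0 by simp
      then show ?thesis unfolding has_field_derivative_def by (rule has_derivative_eq_rhs) (simp add: fun_eq_iff)
    qed
    have H': "(H has_derivative (\<lambda>d. \<mu> * d + \<nu> * cnj d)) (at (Ln (z / z) + \<zeta>))" using H z0 by simp
    have "((\<lambda>w. H (Ln (w / z) + \<zeta>)) has_derivative (\<lambda>d. \<mu> * (d / z) + \<nu> * cnj (d / z))) (at z)"
      by (rule has_derivative_compose[OF L H'])
    then have 1: "((\<lambda>w. cis lam * H (Ln (w / z) + \<zeta>)) has_derivative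
        (\<lambda>d. cis lam * (\<mu> * (d / z) + \<nu> * cnj (d / z)))) (at z)"
      by (rule has_derivative_mult_right)
    have "((\<lambda>w. exp (cis lam * H (Ln (w / z) + \<zeta>))) has_derivative
        (\<lambda>d. exp (cis lam * H (Ln (z / z) + \<zeta>)) * (cis lam * (\<mu> * (d / z) + \<nu> * cnj (d / z))))) (at z)"
      by (rule has_derivative_compose[OF 1 DERIV_exp[unfolded has_field_derivative_def]])
    moreover have "exp (cis lam * H (Ln (z / z) + \<zeta>)) = F z" using F_local[of z \<zeta>] z0 e by simp
    ultimately have 2: "((\<lambda>w. exp (cis lam * H (Ln (w / z) + \<zeta>))) has_derivative
        (\<lambda>d. (F z * cis lam * \<mu> / z) * d + (F z * cis lam * \<nu> / cnj z) * cnj d)) (at z)"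
      by (simp add: algebra_simps)
    have 3: "(F has_derivative
        (\<lambda>d. (F z * cis lam * \<mu> / z) * d + (F z * cis lam * \<nu> / cnj z) * cnj d)) (at z)"
      by (rule has_derivative_transform_within_open[OF 2, of "- {0}"])
         (use z0 e F_local[of _ \<zeta>] in auto)
    have "cmod (F z) / cmod z * cmod \<nu> \<le> cmod (F z) / cmod z * (sin \<beta> * cmod \<mu>)"
      by (intro mult_left_mono b) auto
    then have 4: "cmod (F z * cis lam * \<nu> / cnj z) \<le> sin \<beta> * cmod (F z * cis lam * \<mu> / z)"
      by (simp add: norm_mult norm_divide mult.left_commute)
    have 5: "cmod (F z * cis lam * \<mu> / z)
        \<le> (exp M + cmod (F z)) * K * (2 * (1 + cmod z) powr a * \<bar>cmod z - 1\<bar> powr (- a))"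
    proof -
      have nz: "cmod (exp (- cnj \<zeta>)) = 1 / cmod z"
        using e by (metis complex_cnj exp_cnj exp_minus complex_mod_cnj norm_inverse inverse_eq_divide)
      have lt: "cmod (exp (- cnj \<zeta>)) < 1" unfolding nz using z0 z1 by (simp add: pos_divide_less_eq)
      have "cmod (h' (- cnj \<zeta>)) = cmod (p (exp (- cnj \<zeta>)))" by (simp add: h'_def norm_mult)
      also have "\<dots> \<le> 2 * (1 - 1 / cmod z) powr (- a)"
        using p_bound[OF lt] unfolding nz .
      also have "(1 - 1 / cmod z) powr (- a) = cmod z powr a * (cmod z - 1) powr (- a)"
      proof -
        have "1 - 1 / cmod z = (cmod z - 1) / cmod z" using z0 by (simp add: field_simps)
        then show ?thesis by (simp only: powr_divide) (simp add: powr_minus_divide)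
      qed
      also have "\<dots> \<le> (1 + cmod z) powr a * (cmod z - 1) powr (- a)"
        using a by (intro mult_right_mono powr_mono2) auto
      finally have hb: "cmod (h' (- cnj \<zeta>)) \<le> 2 * (1 + cmod z) powr a * \<bar>cmod z - 1\<bar> powr (- a)"
        using z1 by simp
      have "cmod \<mu> \<le> K * (2 * (1 + cmod z) powr a * \<bar>cmod z - 1\<bar> powr (- a))"
        using K by (intro order_trans[OF g] mult_mono hb) auto
      moreover have "cmod (F z) / cmod z \<le> exp M + cmod (F z)"
      proof -
        have "cmod (F z) / cmod z \<le> cmod (F z) / 1" using z1 by (intro divide_left_mono) auto
        also have "\<dots> \<le> exp M + cmod (F z)" by simp
        finally show ?thesis .
      qed
      ultimately have "cmod (F z) / cmod z * cmod \<mu>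
          \<le> (exp M + cmod (F z)) * (K * (2 * (1 + cmod z) powr a * \<bar>cmod z - 1\<bar> powr (- a)))"
        by (intro mult_mono) (auto intro: add_nonneg_nonneg)
      then show ?thesis by (simp add: norm_mult norm_divide mult.assoc)
    qed
    show ?thesis using 3 4 5 by blast
  qed
  define ok where "ok z w \<longleftrightarrow> (F has_derivative (\<lambda>d. fst w * d + snd w * cnj d)) (at z) \<and> cmod (snd w) \<le> sin \<beta> * cmod (fst w)
      \<and> cmod (fst w) \<le> (exp M + cmod (F z)) * K * (2 * (1 + cmod z) powr a * \<bar>cmod z - 1\<bar> powr (- a))"
    for z w
  have "\<exists>w. cmod z \<noteq> 1 \<longrightarrow> ok z w" for z
    using derF[of z] by (cases "cmod z = 1") (auto simp: ok_def)
  then obtain w where w: "\<And>z. cmod z \<noteq> 1 \<longrightarrow> ok z (w z)"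
    using choice[of "\<lambda>z w. cmod z \<noteq> 1 \<longrightarrow> ok z w"] by blast
  define \<mu> \<nu> where "\<mu> z = fst (w z)" and "\<nu> z = snd (w z)" for z
  have d: "(F has_derivative (\<lambda>d. \<mu> z * d + \<nu> z * cnj d)) (at z)" "cmod (\<nu> z) \<le> sin \<beta> * cmod (\<mu> z)"
    "cmod (\<mu> z) \<le> (exp M + cmod (F z)) * K * (2 * (1 + cmod z) powr a * \<bar>cmod z - 1\<bar> powr (- a))"
    if "cmod z \<noteq> 1" for z
    using w[of z] that unfolding ok_def \<mu>_def \<nu>_def by blast+
  have "quasiconformal (sin \<beta>) F"
  proof (rule quasiconformal_off_circle[OF sin0 _ F_cont homeo d(1,2) a])
    have "sin \<beta> < sin (pi / 2)" using beta by (intro sin_monotone_2pi) auto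
    then show "sin \<beta> < 1" by simp
    fix R
    have "compact (F ` cball 0 R)" by (intro compact_continuous_image continuous_on_subset[OF F_cont]) auto
    then obtain B where B: "\<And>z. cmod z \<le> R \<Longrightarrow> cmod (F z) \<le> B"
      by (force dest!: compact_imp_bounded simp: bounded_iff)
    show "\<exists>C. \<forall>z. cmod z \<le> R \<longrightarrow> cmod z \<noteq> 1 \<longrightarrow> cmod (\<mu> z) \<le> C * \<bar>cmod z - 1\<bar> powr (- a)"
    proof (intro exI allI impI)
      fix z assume z: "cmod z \<le> R" "cmod z \<noteq> 1"
      have "cmod (\<mu> z) \<le> (exp M + cmod (F z)) * K * (2 * (1 + cmod z) powr a * \<bar>cmod z - 1\<bar> powr (- a))"
        by (rule d(3)[OF z(2)])
      also have "\<dots> \<le> (exp M + B) * K * (2 * (1 + R) powr a * \<bar>cmod z - 1\<bar> powr (- a))"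
      proof (rule mult_mono)
        have B0: "0 \<le> B" using B[OF z(1)] norm_ge_zero order_trans by blast
        show "(exp M + cmod (F z)) * K \<le> (exp M + B) * K"
          using B[OF z(1)] K(1) by (intro mult_right_mono) auto
        show "0 \<le> (exp M + B) * K" using B0 K(1) by simp
        have "(1 + cmod z) powr a \<le> (1 + R) powr a"
          using z(1) a by (intro powr_mono2) auto
        then show "2 * (1 + cmod z) powr a * \<bar>cmod z - 1\<bar> powr (- a) \<le> 2 * (1 + R) powr a * \<bar>cmod z - 1\<bar> powr (- a)"
          by (intro mult_right_mono) auto
      qed auto
      also have "\<dots> = ((exp M + B) * K * (2 * (1 + R) powr a)) * \<bar>cmod z - 1\<bar> powr (- a)" by simp
      finally show "cmod (\<mu> z) \<le> ((exp M + B) * K * (2 * (1 + R) powr a)) * \<bar>cmod z - 1\<bar> powr (- a)" .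
    qed
  qed auto
  moreover have "F z = f z" if "z \<in> ball 0 1" for z
    using that fQ[of z] by (simp add: F_def)
  ultimately show ?thesis unfolding \<beta>_def by blast
qed

theorem theorem1p1:
  fixes f :: "complex \<Rightarrow> complex" and \<alpha> :: real
  assumes "0 < \<alpha>" and "\<alpha> < 1"
    and "strongly_spirallike \<alpha> f"
  shows "\<exists>F. quasiconformal (sin (pi * \<alpha> / 2)) F \<and> (\<forall>z\<in>ball 0 1. F z = f z)"
  using assms strongly_spirallike_at_extension unfolding strongly_spirallike_def by blast

end
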